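(* Let $m\ge 1$ be an integer, $1<p_1,\dots,p_m<\infty$, $0\le\alpha<mn$, $\frac1p=\frac1{p_1}+\cdots+\frac1{p_m}$ and $p\le q<\infty$. Let $\omega_1,\dots,\omega_m$ and $v$ be weights on $\mathbb R^n$, put $\sigma_i=\omega_i^{1-p_i'}$ ($i=1,\dots,m$) and $\nu_{\vec\omega}=\prod_{i=1}^m\sigma_i^{p/p_i}$, and define $$[\nu_{\vec\omega},v]_{S_{\vec P,q}}:=\sup_{Q}\frac{\left(\int_Q\left(\mathcal M_\alpha(\sigma_1\chi_Q,\dots,\sigma_m\chi_Q)(x)\right)^q v(x)\,dx\right)^{1/q}}{\left(\nu_{\vec\omega}(Q)\right)^{1/p}},$$ the supremum being over all cubes $Q\subset\mathbb R^n$. If $[\nu_{\vec\omega},v]_{S_{\vec P,q}}<\infty$, then $\mathcal M_\alpha$ is bounded from $L^{p_1}(\omega_1)\times\cdots\times L^{p_m}(\omega_m)$ to $L^q(v)$, and moreover $$\|\mathcal M_\alpha\|_{\left(\prod_{i=1}^m L^{p_i}(\omega_i)\right)\to L^q(v)}\le C\,[\nu_{\vec\omega},v]_{S_{\vec P,q}},$$ where $C>0$ depends only on $n,m,\alpha,p_1,\dots,p_m,q$.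
   Context: Cubes in $\mathbb R^n$ are non-degenerate with sides parallel to the axes; $|Q|$ is Lebesgue measure. A weight is a locally integrable function on $\mathbb R^n$ that is positive almost everywhere; the functions $\sigma_i$ are also assumed to be weights. For a weight $\omega$, $\omega(Q)=\int_Q\omega(x)\,dx$, and $L^p(\omega)$ is the space of measurable $f$ with $\int_{\mathbb R^n}|f|^p\omega\,dx<\infty$. $p_i'$ is the conjugate exponent of $p_i$. The multilinear fractional maximal function is, for $\vec f=(f_1,\dots,f_m)$ measurable, $$\mathcal M_\alpha\vec f(x)=\sup_Q|Q|^{\alpha/n}\prod_{i=1}^m\frac{\chi_Q(x)}{|Q|}\int_Q|f_i(y)|\,dy ,$$ the supremum over all cubes $Q$. $\|\mathcal M_\alpha\|_{(\prod L^{p_i}(\omega_i))\to L^q(v)}$ is the least constant $K$ with $\|\mathcal M_\alpha\vec f\|_{L^q(v)}\le K\prod_{i=1}^m\|f_i\|_{L^{p_i}(\omega_i)}$ for all $\vec f$. *)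

theory Defs
  imports "HOL-Analysis.Analysis"
begin

text \<open>
  Integrals and suprema that may be infinite are taken in \<^typ>\<open>ennreal\<close>. Real powers are only
  taken with positive exponent, except for \<open>|Q| epowr 0\<close> (when \<open>\<alpha> = 0\<close>), which is \<open>1\<close> as
  \<open>0 < |Q| < \<infinity>\<close>.
\<close>

definition epowr :: "ennreal \<Rightarrow> real \<Rightarrow> ennreal" (infixr \<open>epowr\<close> 80) where
  "x epowr a = (if x = \<infinity> then \<infinity> else ennreal (enn2real x powr a))"

text \<open>
  Closed cubes. The suprema below are the same for open or half-open cubes.
\<close>

definition cubes :: "(real ^ 'n) set set" where
  "cubes = {cbox a (a + l *\<^sub>R One) | a l. l > 0}"

text \<open>
  Local integrability includes Lebesgue measurability on each compact set. A weight may take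
  arbitrary values on a null set.
\<close>

definition weight :: "(real ^ 'n \<Rightarrow> real) \<Rightarrow> bool" where
  "weight w \<longleftrightarrow> (\<forall>K. compact K \<longrightarrow> w absolutely_integrable_on K) \<and> (AE x in lebesgue. w x > 0)"

definition weight_of :: "(real ^ 'n \<Rightarrow> real) \<Rightarrow> (real ^ 'n) set \<Rightarrow> ennreal" where
  "weight_of w Q = (\<integral>\<^sup>+x\<in>Q. ennreal (w x) \<partial>lebesgue)"

definition Lp_space :: "real \<Rightarrow> (real ^ 'n \<Rightarrow> real) \<Rightarrow> (real ^ 'n \<Rightarrow> real) set" where
  "Lp_space p w = {f \<in> borel_measurable lebesgue.
     (\<integral>\<^sup>+x. ennreal (\<bar>f x\<bar> powr p) * ennreal (w x) \<partial>lebesgue) < \<infinity>}"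

text \<open>
  The norm is defined for \<open>[0,\<infinity>]\<close>-valued functions, since maximal functions may take the value
  \<open>\<infinity>\<close>; a real function \<open>f\<close> enters through \<open>\<bar>f\<bar>\<close>.
\<close>

definition Lp_norm :: "real \<Rightarrow> (real ^ 'n \<Rightarrow> real) \<Rightarrow> (real ^ 'n \<Rightarrow> ennreal) \<Rightarrow> ennreal" where
  "Lp_norm p w F = (\<integral>\<^sup>+x. F x epowr p * ennreal (w x) \<partial>lebesgue) epowr (1 / p)"

definition conj_exp :: "real \<Rightarrow> real" where
  "conj_exp p = p / (p - 1)"

text \<open>Families \<open>(f\<^sub>1, \<dots>, f\<^sub>m)\<close> are functions on \<^typ>\<open>nat\<close>, of which only the values at
  \<open>1, \<dots>, m\<close> matter.\<close>

definition frac_maximal ::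
  "nat \<Rightarrow> real \<Rightarrow> (nat \<Rightarrow> real ^ 'n \<Rightarrow> real) \<Rightarrow> real ^ 'n \<Rightarrow> ennreal" where
  "frac_maximal m \<alpha> f x =
     (SUP Q \<in> cubes. emeasure lebesgue Q epowr (\<alpha> / real CARD('n)) *
        (\<Prod>i = 1..m. indicator Q x / emeasure lebesgue Q * (\<integral>\<^sup>+y\<in>Q. ennreal \<bar>f i y\<bar> \<partial>lebesgue)))"

definition mult_bounded ::
  "nat \<Rightarrow> (nat \<Rightarrow> real) \<Rightarrow> (nat \<Rightarrow> real ^ 'n \<Rightarrow> real) \<Rightarrow> real \<Rightarrow> (real ^ 'n \<Rightarrow> real) \<Rightarrow>
   ((nat \<Rightarrow> real ^ 'n \<Rightarrow> real) \<Rightarrow> real ^ 'n \<Rightarrow> ennreal) \<Rightarrow> bool" where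
  "mult_bounded m P w q v T \<longleftrightarrow>
     (\<exists>K < \<infinity>. \<forall>f. (\<forall>i\<in>{1..m}. f i \<in> Lp_space (P i) (w i)) \<longrightarrow>
        T f \<in> borel_measurable lebesgue \<and>
        Lp_norm q v (T f) \<le> K * (\<Prod>i = 1..m. Lp_norm (P i) (w i) (\<lambda>x. ennreal \<bar>f i x\<bar>)))"

definition mult_op_norm ::
  "nat \<Rightarrow> (nat \<Rightarrow> real) \<Rightarrow> (nat \<Rightarrow> real ^ 'n \<Rightarrow> real) \<Rightarrow> real \<Rightarrow> (real ^ 'n \<Rightarrow> real) \<Rightarrow>
   ((nat \<Rightarrow> real ^ 'n \<Rightarrow> real) \<Rightarrow> real ^ 'n \<Rightarrow> ennreal) \<Rightarrow> ennreal" where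
  "mult_op_norm m P w q v T =
     Inf {K. \<forall>f. (\<forall>i\<in>{1..m}. f i \<in> Lp_space (P i) (w i)) \<longrightarrow>
        Lp_norm q v (T f) \<le> K * (\<Prod>i = 1..m. Lp_norm (P i) (w i) (\<lambda>x. ennreal \<bar>f i x\<bar>))}"

definition dual_weight :: "(nat \<Rightarrow> real) \<Rightarrow> (nat \<Rightarrow> real ^ 'n \<Rightarrow> real) \<Rightarrow> nat \<Rightarrow> real ^ 'n \<Rightarrow> real" where
  "dual_weight P w i x = w i x powr (1 - conj_exp (P i))"

definition nu_weight ::
  "nat \<Rightarrow> real \<Rightarrow> (nat \<Rightarrow> real) \<Rightarrow> (nat \<Rightarrow> real ^ 'n \<Rightarrow> real) \<Rightarrow> real ^ 'n \<Rightarrow> real" where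
  "nu_weight m p P w x = (\<Prod>i = 1..m. dual_weight P w i x powr (p / P i))"

definition sawyer_const ::
  "nat \<Rightarrow> real \<Rightarrow> real \<Rightarrow> (nat \<Rightarrow> real) \<Rightarrow> real \<Rightarrow>
   (nat \<Rightarrow> real ^ 'n \<Rightarrow> real) \<Rightarrow> (real ^ 'n \<Rightarrow> real) \<Rightarrow> ennreal" where
  "sawyer_const m \<alpha> p P q w v =
     (SUP Q \<in> cubes.
        (\<integral>\<^sup>+x\<in>Q. frac_maximal m \<alpha> (\<lambda>i y. dual_weight P w i y * indicator Q y) x epowr q
            * ennreal (v x) \<partial>lebesgue) epowr (1 / q)
        / weight_of (nu_weight m p P w) Q epowr (1 / p))"

end

theory Submission
  imports Defs
begin

text \<open>
  Put \<open>c\<^sub>i(Q) = \<integral>\<^sub>Q |f\<^sub>i| / \<sigma>\<^sub>i(Q)\<close>, and write \<open>A\<^sub>Q\<close> for the average over \<open>Q\<close> that enters the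
  maximal function, so that \<open>A\<^sub>Q(f) = A\<^sub>Q(\<sigma>) * (\<Prod>i. c\<^sub>i(Q))\<close>. By the one-third trick the maximal
  function is controlled by those of \<open>2 ^ n\<close> dyadic grids, and by monotone convergence finite
  families of dyadic cubes suffice.

  For a finite family let \<open>E\<^sub>Q \<subseteq> Q\<close> be the set on which \<open>Q\<close> realises the maximum. Then the integral
  to be bounded is \<open>\<Sum>Q. \<tau>\<^sub>Q * (\<Prod>i. c\<^sub>i(Q)) ^ q\<close> with \<open>\<tau>\<^sub>Q = A\<^sub>Q(\<sigma>) ^ q * v(E\<^sub>Q)\<close>. The
  testing condition says precisely that \<open>\<tau>\<close> is a Carleson sequence of order \<open>q / p \<ge> 1\<close> for \<open>\<nu>\<close>, so
  a Carleson embedding bounds the sum by a power of \<open>\<integral> (max (\<Prod>i. c\<^sub>i(Q))) ^ p d\<nu>\<close>. As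
  \<open>\<nu> = (\<Prod>i. \<sigma>\<^sub>i powr (p / p\<^sub>i))\<close> with exponents of sum \<open>1\<close>, the inequality of arithmetic and
  geometric means separates the factors, and Doob's inequality for the dyadic maximal function
  with respect to \<open>\<sigma>\<^sub>i\<close> bounds each of them by \<open>\<integral> |f\<^sub>i| powr p\<^sub>i * w\<^sub>i\<close>.
\<close>

section \<open>Finite laminar families\<close>

text \<open>Multiply the hypothesis by \<open>l powr (s - r - 1)\<close> and integrate over
  \<open>l\<close>: cut off at \<open>u Q\<close>, the powers \<open>l powr (s - 1)\<close> and
  \<open>l powr (s - r - 1)\<close> integrate to \<open>u Q powr s / s\<close> and
  \<open>u Q powr (s - r) / (s - r)\<close>. It is applied with \<open>r = s - 1\<close> in the
  Carleson embedding and with \<open>r = 1\<close> and \<open>r = 0\<close> in Doob's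
  inequality.\<close>

lemma layer_cake_sum:
  fixes a b u :: "'i \<Rightarrow> real"
  assumes fin: "finite F" and u: "\<And>Q. Q \<in> F \<Longrightarrow> 0 \<le> u Q" and r: "0 \<le> r" "r < s"
    and le: "\<And>l. 0 < l \<Longrightarrow> l powr r * (\<Sum>Q | Q \<in> F \<and> l \<le> u Q. a Q) \<le> (\<Sum>Q | Q \<in> F \<and> l \<le> u Q. b Q)"
  shows "(\<Sum>Q\<in>F. a Q * u Q powr s) \<le> s / (s - r) * (\<Sum>Q\<in>F. b Q * u Q powr (s - r))"
proof -
  define h where "h t Q l = (if l \<in> {0..u Q} then l powr (t - 1) else 0)" for t Q l
  have h: "(h t Q has_integral (u Q powr t / t)) UNIV" if "Q \<in> F" "0 < t" for t Q
    using has_integral_powr_from_0[of "t - 1" "u Q"] that u[OF that(1)]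
    unfolding h_def by (subst has_integral_restrict_UNIV) auto
  have ineq: "(\<Sum>Q\<in>F. a Q * h s Q l) \<le> (\<Sum>Q\<in>F. b Q * h (s - r) Q l)" for l
  proof (cases "0 < l")
    case True
    have *: "(\<Sum>Q\<in>F. c Q * h t Q l) = l powr (t - 1) * (\<Sum>Q | Q \<in> F \<and> l \<le> u Q. c Q)" for c t
      using True fin by (auto simp: h_def sum.inter_filter sum_distrib_left intro!: sum.cong)
    have "l powr (s - 1) = l powr (s - r - 1) * l powr r"
      by (simp flip: powr_add)
    then show ?thesis
      unfolding * using le[OF True] by (simp add: mult.assoc mult_left_mono)
  next
    case False
    \<comment> \<open>At \<open>l = 0\<close> this uses the convention that
      \<open>0 powr a = 0\<close> for every exponent, negative ones included.\<close>
    then have "h t Q l = 0" for t Q by (cases "l = 0") (auto simp: h_def)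
    then show ?thesis by simp
  qed
  have "((\<lambda>l. \<Sum>Q\<in>F. c Q * h t Q l) has_integral (\<Sum>Q\<in>F. c Q * (u Q powr t / t))) UNIV"
    if "0 < t" for c t
    using that by (intro has_integral_sum[OF fin] has_integral_mult_right h)
  note I = this
  have "(\<Sum>Q\<in>F. a Q * (u Q powr s / s)) \<le> (\<Sum>Q\<in>F. b Q * (u Q powr (s - r) / (s - r)))"
    using r by (intro has_integral_le[OF I[of s a] I[of "s - r" b] ineq]) auto
  then have "s * (\<Sum>Q\<in>F. a Q * (u Q powr s / s)) \<le> s * (\<Sum>Q\<in>F. b Q * (u Q powr (s - r) / (s - r)))"
    using r by (intro mult_left_mono) auto
  moreover have "s * (\<Sum>Q\<in>F. a Q * (u Q powr s / s)) = (\<Sum>Q\<in>F. a Q * u Q powr s)"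
    using r by (simp add: sum_distrib_left)
  moreover have "s * (\<Sum>Q\<in>F. b Q * (u Q powr (s - r) / (s - r)))
      = s / (s - r) * (\<Sum>Q\<in>F. b Q * u Q powr (s - r))"
    by (simp add: sum_distrib_left mult_ac)
  ultimately show ?thesis by simp
qed

text \<open>Members are inserted in order of increasing \<open>u\<close>. The new one has the
  largest value so far, so it takes all of its points and the older pieces keep what remains. A sum
  of \<open>u Q\<close> times the measure of \<open>G Q\<close> is then the integral of the
  pointwise maximum of \<open>u\<close> over the members containing the point.\<close>

lemma maximal_selection:
  fixes u :: "'a set \<Rightarrow> real"
  assumes "finite F" "F \<subseteq> sets M"
  obtains G where "\<And>Q. Q \<in> F \<Longrightarrow> G Q \<in> sets M" "\<And>Q. Q \<in> F \<Longrightarrow> G Q \<subseteq> Q"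
    "disjoint_family_on G F" "\<And>Q x. Q \<in> F \<Longrightarrow> x \<in> Q \<Longrightarrow> \<exists>R\<in>F. x \<in> G R \<and> u Q \<le> u R"
proof -
  have "\<exists>G. (\<forall>Q\<in>F. G Q \<in> sets M \<and> G Q \<subseteq> Q) \<and> disjoint_family_on G F \<and>
         (\<forall>Q\<in>F. \<forall>x\<in>Q. \<exists>R\<in>F. x \<in> G R \<and> u Q \<le> u R)"
    using assms
  proof (induction rule: finite_ranking_induct[where f = u])
    case empty
    then show ?case by (simp add: disjoint_family_on_def)
  next
    case (insert P F)
    from insert.prems have F: "P \<in> sets M" "F \<subseteq> sets M" by auto
    obtain G where "\<forall>Q\<in>F. G Q \<in> sets M \<and> G Q \<subseteq> Q" "disjoint_family_on G F"
      "\<forall>Q\<in>F. \<forall>x\<in>Q. \<exists>R\<in>F. x \<in> G R \<and> u Q \<le> u R"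
      using insert.IH[OF F(2)] by (elim exE conjE)
    then have G: "\<And>Q. Q \<in> F \<Longrightarrow> G Q \<in> sets M" "\<And>Q. Q \<in> F \<Longrightarrow> G Q \<subseteq> Q"
      "disjoint_family_on G F" "\<And>Q x. Q \<in> F \<Longrightarrow> x \<in> Q \<Longrightarrow> \<exists>R\<in>F. x \<in> G R \<and> u Q \<le> u R"
      by simp_all
    show ?case
    proof (intro exI[of _ "\<lambda>Q. if Q = P then P else G Q - P"] conjI ballI)
      show "disjoint_family_on (\<lambda>Q. if Q = P then P else G Q - P) (insert P F)"
        using G(3) by (auto simp: disjoint_family_on_def)
    next
      fix Q x assume *: "Q \<in> insert P F" "x \<in> Q"
      show "\<exists>R\<in>insert P F. x \<in> (if R = P then P else G R - P) \<and> u Q \<le> u R"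
      proof (cases "x \<in> P")
        case True
        then show ?thesis using * insert.hyps(2) by (intro bexI[of _ P]) auto
      next
        case False
        then obtain R where "R \<in> F" "x \<in> G R" "u Q \<le> u R" using G(4)[of Q x] * by auto
        then show ?thesis using False G(2)[of R] by (intro bexI[of _ R]) auto
      qed
    next
      fix Q assume "Q \<in> insert P F"
      then show "(if Q = P then P else G Q - P) \<in> sets M" "(if Q = P then P else G Q - P) \<subseteq> Q"
        using G(1,2)[of Q] F by auto
    qed
  qed
  then obtain G where "\<forall>Q\<in>F. G Q \<in> sets M \<and> G Q \<subseteq> Q" "disjoint_family_on G F"
    "\<forall>Q\<in>F. \<forall>x\<in>Q. \<exists>R\<in>F. x \<in> G R \<and> u Q \<le> u R" by blast
  then show ?thesis using that[of G] by simp
qed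

definition laminar :: "'a set set \<Rightarrow> bool" where
  "laminar F \<longleftrightarrow> (\<forall>Q\<in>F. \<forall>R\<in>F. Q \<inter> R = {} \<or> Q \<subseteq> R \<or> R \<subseteq> Q)"

text \<open>Distinct inclusion-maximal members cannot be nested, so they are disjoint; finiteness
  puts every member below a maximal one.\<close>

lemma laminar_maximal:
  assumes "finite F" "laminar F"
  obtains S where "S \<subseteq> F" "disjoint S" "\<And>Q. Q \<in> F \<Longrightarrow> \<exists>R\<in>S. Q \<subseteq> R"
proof
  let ?S = "{R\<in>F. \<forall>Q\<in>F. R \<subseteq> Q \<longrightarrow> Q = R}"
  show "?S \<subseteq> F" by auto
  show "disjoint ?S"
  proof (rule pairwiseI)
    fix Q R assume "Q \<in> ?S" "R \<in> ?S" "Q \<noteq> R"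
    moreover from this have "Q \<inter> R = {} \<or> Q \<subseteq> R \<or> R \<subseteq> Q"
      using assms(2) by (simp add: laminar_def)
    ultimately show "disjnt Q R" by (auto simp: disjnt_def)
  qed
  show "\<exists>R\<in>?S. Q \<subseteq> R" if "Q \<in> F" for Q
    using finite_has_maximal2[OF assms(1) that] by auto
qed

text \<open>A point of a member with \<open>l \<le> u Q\<close> lies in some piece
  \<open>G R\<close> with \<open>u Q \<le> u R\<close>, so the pieces of the superlevel family
  partition its union. Sums over pieces thus become measures of superlevel sets.\<close>

lemma selection_superlevel:
  fixes u :: "'a set \<Rightarrow> real"
  assumes "finite F" "F \<subseteq> sets M" "\<And>Q. Q \<in> F \<Longrightarrow> emeasure M Q \<noteq> \<infinity>"
    and G: "\<And>Q. Q \<in> F \<Longrightarrow> G Q \<in> sets M" "\<And>Q. Q \<in> F \<Longrightarrow> G Q \<subseteq> Q" "disjoint_family_on G F"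
      "\<And>Q x. Q \<in> F \<Longrightarrow> x \<in> Q \<Longrightarrow> \<exists>R\<in>F. x \<in> G R \<and> u Q \<le> u R"
  shows "(\<Sum>Q | Q \<in> F \<and> l \<le> u Q. measure M (G Q)) = measure M (\<Union>{Q\<in>F. l \<le> u Q})"
proof -
  have "emeasure M (G Q) \<noteq> \<infinity>" if "Q \<in> F" for Q
    using emeasure_mono[OF G(2)[OF that], of M] assms(2,3) that by (auto simp: top_unique)
  moreover have "(\<Union>Q\<in>{Q\<in>F. l \<le> u Q}. G Q) = \<Union>{Q\<in>F. l \<le> u Q}"
  proof (intro subset_antisym subsetI)
    fix x assume "x \<in> \<Union>{Q\<in>F. l \<le> u Q}"
    then obtain Q where "Q \<in> F" "x \<in> Q" "l \<le> u Q" by auto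
    moreover then obtain R where "R \<in> F" "x \<in> G R" "u Q \<le> u R" using G(4)[of Q x] by auto
    ultimately show "x \<in> (\<Union>Q\<in>{Q\<in>F. l \<le> u Q}. G Q)" by fastforce
  qed (use G(2) in blast)
  ultimately show ?thesis
    using assms(1) G(1,3)
    by (subst measure_finite_Union[symmetric])
       (auto intro: disjoint_family_on_mono[of _ F])
qed

lemma laminar_Union_disjoint:
  assumes "finite F" "laminar F"
  shows "\<exists>S\<subseteq>F. disjoint S \<and> \<Union>S = \<Union>F \<and> (\<forall>Q\<in>F. \<exists>R\<in>S. Q \<subseteq> R)"
proof -
  obtain S where S: "S \<subseteq> F" "disjoint S" "\<And>Q. Q \<in> F \<Longrightarrow> \<exists>R\<in>S. Q \<subseteq> R"
    using laminar_maximal[OF assms] by auto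
  from this have "\<Union>S = \<Union>F" by blast
  then show ?thesis using S by (intro exI[of _ S]) simp
qed

lemma measure_disjoint_Union:
  assumes "finite S" "disjoint S" "S \<subseteq> sets M" "\<And>Q. Q \<in> S \<Longrightarrow> emeasure M Q \<noteq> \<infinity>"
  shows "measure M (\<Union>S) = (\<Sum>R\<in>S. measure M R)"
  using measure_finite_Union[of S id M] assms
  by (simp add: disjoint_family_on_def pairwise_def disjnt_def)

text \<open>Carries a pointwise bound over to real-valued measures. It serves both the two-term
  Young-type bound and the \<open>m\<close>-term arithmetic-geometric mean bound. Finiteness on the
  right keeps \<open>enn2real\<close> monotone, since \<open>enn2real\<close> sends infinity to
  0.\<close>

lemma measure_density_le_sum:
  fixes h :: "'a \<Rightarrow> real" and k :: "'i \<Rightarrow> 'a \<Rightarrow> real"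
  assumes "finite I" and [measurable]: "h \<in> borel_measurable M" "A \<in> sets M"
    and k: "\<And>i. i \<in> I \<Longrightarrow> k i \<in> borel_measurable M" "\<And>i x. i \<in> I \<Longrightarrow> 0 \<le> k i x"
    and "0 \<le> a" "\<And>i. i \<in> I \<Longrightarrow> 0 \<le> b i"
    and fin: "\<And>i. i \<in> I \<Longrightarrow> emeasure (density M (\<lambda>x. ennreal (k i x))) A \<noteq> \<infinity>"
    and le: "AE x in M. x \<in> A \<longrightarrow> a * h x \<le> (\<Sum>i\<in>I. b i * k i x)"
  shows "a * measure (density M (\<lambda>x. ennreal (h x))) A
    \<le> (\<Sum>i\<in>I. b i * measure (density M (\<lambda>x. ennreal (k i x))) A)"
proof -
  have "ennreal a * emeasure (density M (\<lambda>x. ennreal (h x))) A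
      = (\<integral>\<^sup>+x. ennreal a * (ennreal (h x) * indicator A x) \<partial>M)"
    by (simp add: emeasure_density nn_integral_cmult)
  also have "\<dots> \<le> (\<integral>\<^sup>+x. (\<Sum>i\<in>I. ennreal (b i) * (ennreal (k i x) * indicator A x)) \<partial>M)"
  proof (rule nn_integral_mono_AE, use le in eventually_elim)
    case (elim x)
    show ?case
    proof (cases "x \<in> A")
      case True
      then have "ennreal (a * h x) \<le> ennreal (\<Sum>i\<in>I. b i * k i x)"
        using elim by (intro ennreal_leI) auto
      then show ?thesis
        using True assms by (simp add: ennreal_mult' sum_ennreal[symmetric])
    qed simp
  qed
  also have "\<dots> = (\<Sum>i\<in>I. ennreal (b i) * emeasure (density M (\<lambda>x. ennreal (k i x))) A)"
    using k by (subst nn_integral_sum) (auto simp: nn_integral_cmult emeasure_density intro!: sum.cong)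
  finally have *: "ennreal a * emeasure (density M (\<lambda>x. ennreal (h x))) A \<le> \<dots>" .
  have "(\<Sum>i\<in>I. ennreal (b i) * emeasure (density M (\<lambda>x. ennreal (k i x))) A)
      = ennreal (\<Sum>i\<in>I. b i * measure (density M (\<lambda>x. ennreal (k i x))) A)"
    using fin assms(7) by (subst sum_ennreal[symmetric])
      (auto simp: emeasure_eq_ennreal_measure ennreal_mult' intro!: sum.cong)
  from enn2real_mono[OF *[unfolded this]] show ?thesis
    using assms by (simp add: enn2real_mult measure_def sum_nonneg)
qed

section \<open>Carleson embedding\<close>

lemma sum_powr_le_powr_sum:
  fixes x :: "'i \<Rightarrow> real"
  assumes "finite I" "\<And>i. i \<in> I \<Longrightarrow> 0 \<le> x i" "1 \<le> s"
  shows "(\<Sum>i\<in>I. x i powr s) \<le> (\<Sum>i\<in>I. x i) powr s"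
proof -
  have *: "y powr s = y * y powr (s - 1)" if "0 \<le> y" for y :: real
    using that by (cases "y = 0") (auto simp: powr_diff)
  have "(\<Sum>i\<in>I. x i powr s) \<le> (\<Sum>i\<in>I. x i * (\<Sum>i\<in>I. x i) powr (s - 1))"
    using assms by (intro sum_mono) (auto simp: * intro!: mult_left_mono powr_mono2 member_le_sum)
  also have "\<dots> = (\<Sum>i\<in>I. x i) powr s"
    using assms by (simp add: * sum_nonneg sum_distrib_right)
  finally show ?thesis .
qed

text \<open>Let \<open>U\<close> be the union of the members with \<open>l \<le> u Q\<close>, and
  \<open>B\<close> the integral of the maximum of \<open>u\<close>. Splitting along the disjoint
  maximal members bounds the sum of \<open>\<tau>\<close> at level \<open>l\<close> by
  \<open>T * measure M U powr s\<close>. Chebyshev's inequality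
  \<open>l * measure M U \<le> B\<close> trades \<open>s - 1\<close> of these powers for
  \<open>B powr (s - 1)\<close>, at the price of \<open>l powr (s - 1)\<close>. What is left is
  linear in the measure of \<open>U\<close>, and the layer cake with \<open>r = s - 1\<close> sums
  it up.\<close>

lemma carleson_embedding:
  fixes \<tau> u :: "'a set \<Rightarrow> real"
  assumes F: "finite F" "laminar F" "F \<subseteq> sets M" "\<And>Q. Q \<in> F \<Longrightarrow> emeasure M Q \<noteq> \<infinity>"
    and "0 \<le> T" "1 \<le> s" and \<tau>: "\<And>Q. Q \<in> F \<Longrightarrow> 0 \<le> \<tau> Q" and u: "\<And>Q. Q \<in> F \<Longrightarrow> 0 \<le> u Q"
    and carleson: "\<And>R. R \<in> F \<Longrightarrow> (\<Sum>Q | Q \<in> F \<and> Q \<subseteq> R. \<tau> Q) \<le> T * measure M R powr s"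
    and G: "\<And>Q. Q \<in> F \<Longrightarrow> G Q \<in> sets M" "\<And>Q. Q \<in> F \<Longrightarrow> G Q \<subseteq> Q" "disjoint_family_on G F"
      "\<And>Q x. Q \<in> F \<Longrightarrow> x \<in> Q \<Longrightarrow> \<exists>R\<in>F. x \<in> G R \<and> u Q \<le> u R"
  shows "(\<Sum>Q\<in>F. \<tau> Q * u Q powr s) \<le> s * T * (\<Sum>Q\<in>F. u Q * measure M (G Q)) powr s"
proof -
  define B where "B = (\<Sum>Q\<in>F. u Q * measure M (G Q))"
  have "0 \<le> B" unfolding B_def using u by (intro sum_nonneg) auto
  have *: "y powr s = y powr (s - 1) * y" if "0 \<le> y" for y :: real
    using that by (cases "y = 0") (auto simp: powr_diff)
  have "(\<Sum>Q\<in>F. \<tau> Q * u Q powr s)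
      \<le> s / (s - (s - 1)) * (\<Sum>Q\<in>F. (T * B powr (s - 1) * measure M (G Q)) * u Q powr (s - (s - 1)))"
  proof (rule layer_cake_sum)
    fix l :: real assume "0 < l"
    let ?F = "{Q\<in>F. l \<le> u Q}"
    let ?U = "\<Union>?F"
    have F': "finite ?F" "laminar ?F" using F by (auto simp: laminar_def)
    obtain S where S: "S \<subseteq> ?F" "disjoint S" "\<Union>S = ?U" "\<forall>Q\<in>?F. \<exists>R\<in>S. Q \<subseteq> R"
      using laminar_Union_disjoint[OF F'] by (elim exE conjE)
    \<comment> \<open>Each member is charged to one maximal member containing it, so that the
      Carleson condition can be applied once per maximal member.\<close>
    define r where "r Q = (SOME R. R \<in> S \<and> Q \<subseteq> R)" for Q
    have r: "r Q \<in> S \<and> Q \<subseteq> r Q" if "Q \<in> ?F" for Q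
      unfolding r_def using S(4)[rule_format, OF that] by (intro someI_ex[of "\<lambda>R. R \<in> S \<and> Q \<subseteq> R"]) auto
    have fS: "finite S" using S(1) F(1) finite_subset by fastforce
    have U: "measure M ?U = (\<Sum>R\<in>S. measure M R)"
      unfolding S(3)[symmetric] using S F fS by (intro measure_disjoint_Union) auto
    have "(\<Sum>Q\<in>?F. \<tau> Q) = (\<Sum>R\<in>S. \<Sum>Q | Q \<in> ?F \<and> r Q = R. \<tau> Q)"
      using fS F(1) r by (intro sum.group[symmetric]) auto
    also have "\<dots> \<le> (\<Sum>R\<in>S. \<Sum>Q | Q \<in> F \<and> Q \<subseteq> R. \<tau> Q)"
      using F(1) \<tau> r by (intro sum_mono sum_mono2) auto
    also have "\<dots> \<le> (\<Sum>R\<in>S. T * measure M R powr s)"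
      using S(1) by (intro sum_mono carleson) auto
    \<comment> \<open>For exponents \<open>s\<close> at least 1, powers are superadditive over the
      disjoint maximal members.\<close>
    also have "\<dots> \<le> T * measure M ?U powr s"
      unfolding U using \<open>0 \<le> T\<close> \<open>1 \<le> s\<close> fS
      by (simp flip: sum_distrib_left add: mult_left_mono sum_powr_le_powr_sum)
    finally have 1: "(\<Sum>Q\<in>?F. \<tau> Q) \<le> T * measure M ?U powr s" .
    have U2: "(\<Sum>Q\<in>?F. measure M (G Q)) = measure M ?U"
      using F G by (intro selection_superlevel) auto
    \<comment> \<open>Chebyshev's inequality for the function with value \<open>u Q\<close> on
      \<open>G Q\<close>.\<close>
    have "l * measure M ?U \<le> (\<Sum>Q\<in>?F. u Q * measure M (G Q))"
      unfolding U2[symmetric] sum_distrib_left by (intro sum_mono mult_right_mono) auto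
    also have "\<dots> \<le> B"
      unfolding B_def using F u by (intro sum_mono2) auto
    finally have 2: "l * measure M ?U \<le> B" .
    have "l powr (s - 1) * (\<Sum>Q\<in>?F. \<tau> Q) \<le> l powr (s - 1) * (T * measure M ?U powr s)"
      using 1 by (intro mult_left_mono) auto
    also have "\<dots> = T * (l * measure M ?U) powr (s - 1) * measure M ?U"
      using \<open>0 < l\<close> by (simp add: * powr_mult)
    also have "\<dots> \<le> T * B powr (s - 1) * measure M ?U"
      using 2 \<open>0 < l\<close> \<open>0 \<le> T\<close> \<open>1 \<le> s\<close>
      by (intro mult_right_mono mult_left_mono powr_mono2) auto
    finally show "l powr (s - 1) * (\<Sum>Q\<in>?F. \<tau> Q) \<le> (\<Sum>Q\<in>?F. T * B powr (s - 1) * measure M (G Q))"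
      by (simp add: U2 flip: sum_distrib_left)
  qed (use F u \<open>1 \<le> s\<close> in auto)
  also have "\<dots> = s * T * (B powr (s - 1) * B)"
    unfolding B_def sum_distrib_left using u by (auto intro!: sum.cong)
  also have "\<dots> = s * T * B powr s" using \<open>0 \<le> B\<close> by (simp add: *)
  finally show ?thesis by (simp add: B_def)
qed

section \<open>Doob's inequality for a laminar family\<close>

lemma young_absorption:
  fixes c h \<sigma> p :: real
  assumes "1 < p" "0 \<le> c" "0 \<le> h" "0 < \<sigma>"
  defines "p' \<equiv> p / (p - 1)"
  shows "p' * c powr (p - 1) * h
    \<le> c powr p / 2 * \<sigma> + (2 * p') powr p / 2 * (h powr p * \<sigma> powr (1 - p))"
proof -
  have *: "y powr p = y powr (p - 1) * y" if "0 \<le> y" for y :: real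
    using that by (cases "y = 0") (auto simp: powr_diff)
  have p': "0 < p'" using assms by (simp add: p'_def)
  show ?thesis
  \<comment> \<open>If \<open>h\<close> is small compared with \<open>c * \<sigma>\<close>, the left
    side is at most the first term. Otherwise \<open>c\<close> is at most
    \<open>2 * p' * (h / \<sigma>)\<close>, and replacing it gives the second term, because
    \<open>(2 * p') powr (p - 1) * p' = (2 * p') powr p / 2\<close>. The factor 1/2 in the first
    term is what later permits absorption.\<close>
  proof (cases "2 * p' * h \<le> c * \<sigma>")
    case True
    then have "c powr (p - 1) * (p' * h) \<le> c powr (p - 1) * (c * \<sigma> / 2)"
      by (intro mult_left_mono) auto
    also have "\<dots> = c powr p / 2 * \<sigma>" using assms by (simp add: *)
    finally show ?thesis by (simp add: mult_ac add_increasing2)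
  next
    case False
    then have "c \<le> 2 * p' * (h / \<sigma>)" using assms by (simp add: field_simps)
    then have "c powr (p - 1) * (p' * h) \<le> (2 * p' * (h / \<sigma>)) powr (p - 1) * (p' * h)"
      using assms p' by (intro mult_right_mono powr_mono2) auto
    also have "\<dots> = (2 * p') powr p / 2 * ((h / \<sigma>) powr p * \<sigma>)"
      using p' \<open>0 \<le> h\<close> \<open>0 < \<sigma>\<close> powr_mult[of "2 * p'" "h / \<sigma>" "p - 1"] by (simp add: *)
    also have "(h / \<sigma>) powr p * \<sigma> = h powr p * \<sigma> powr (1 - p)"
      using assms by (simp add: powr_divide powr_diff)
    finally show ?thesis using assms by (simp add: mult_ac add_increasing)
  qed
qed

text \<open>The weak type (1,1) bound with constant 1: the superlevel set is the disjoint union of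
  the maximal members with \<open>l \<le> c R\<close>, and on each of them
  \<open>l * measure M R \<le> measure N R\<close>.\<close>

lemma laminar_selection_weak_type:
  fixes c :: "'a set \<Rightarrow> real"
  assumes F: "finite F" "laminar F" "F \<subseteq> sets M" and sets: "sets N = sets M"
    and fin: "\<And>Q. Q \<in> F \<Longrightarrow> emeasure M Q \<noteq> \<infinity>" "\<And>Q. Q \<in> F \<Longrightarrow> emeasure N Q \<noteq> \<infinity>"
    and c: "\<And>Q. Q \<in> F \<Longrightarrow> c Q * measure M Q \<le> measure N Q"
    and G: "\<And>Q. Q \<in> F \<Longrightarrow> G Q \<in> sets M" "\<And>Q. Q \<in> F \<Longrightarrow> G Q \<subseteq> Q" "disjoint_family_on G F"
      "\<And>Q x. Q \<in> F \<Longrightarrow> x \<in> Q \<Longrightarrow> \<exists>R\<in>F. x \<in> G R \<and> c Q \<le> c R"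
  shows "l * (\<Sum>Q | Q \<in> F \<and> l \<le> c Q. measure M (G Q)) \<le> (\<Sum>Q | Q \<in> F \<and> l \<le> c Q. measure N (G Q))"
proof -
  let ?F = "{Q\<in>F. l \<le> c Q}"
  let ?U = "\<Union>?F"
  have F': "finite ?F" "laminar ?F" using F by (auto simp: laminar_def)
  obtain S where S: "S \<subseteq> ?F" "disjoint S" "\<Union>S = ?U"
    using laminar_Union_disjoint[OF F'] by (elim exE conjE)
  have fS: "finite S" using S(1) F(1) finite_subset by fastforce
  have "l * measure M ?U = (\<Sum>R\<in>S. l * measure M R)"
    unfolding S(3)[symmetric] sum_distrib_left[symmetric]
    using S F fS fin by (subst measure_disjoint_Union) auto
  also have "\<dots> \<le> (\<Sum>R\<in>S. measure N R)"
  proof (rule sum_mono)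
    fix R assume "R \<in> S"
    then have "R \<in> F" "l \<le> c R" using S(1) by auto
    then have "l * measure M R \<le> c R * measure M R" by (intro mult_right_mono) auto
    also have "\<dots> \<le> measure N R" using \<open>R \<in> F\<close> by (rule c)
    finally show "l * measure M R \<le> measure N R" .
  qed
  also have "\<dots> = measure N ?U"
    unfolding S(3)[symmetric] using S F fS fin sets by (subst measure_disjoint_Union) auto
  finally show ?thesis
    using selection_superlevel[OF F(1,3) fin(1) G, of l]
      selection_superlevel[OF F(1) _ fin(2) _ G(2-4), of l] F(3) G(1) sets by simp
qed

text \<open>The weak type bound and the layer cake with \<open>r = 1\<close> estimate the
  \<open>p\<close>-th power integral \<open>D\<close> of the maximum of \<open>c\<close> by an
  integral of \<open>c powr (p - 1)\<close> against \<open>H\<close>; the Young-type bound turns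
  this into \<open>D / 2\<close> plus a multiple of \<open>W\<close>. The disjoint sets
  \<open>E\<close> are arbitrary because they will later be selected for the product of the averages
  of all \<open>m\<close> functions, not for the averages of a single one.\<close>

lemma laminar_doob:
  fixes M :: "'a measure" and h \<sigma> :: "'a \<Rightarrow> real" and p W :: real
  defines "S \<equiv> density M (\<lambda>x. ennreal (\<sigma> x))" and "H \<equiv> density M (\<lambda>x. ennreal (h x))"
  assumes F: "finite F" "laminar F" "F \<subseteq> sets M" and p: "1 < p"
    and [measurable]: "h \<in> borel_measurable M" "\<sigma> \<in> borel_measurable M"
    and h: "\<And>x. 0 \<le> h x" and \<sigma>: "AE x in M. 0 < \<sigma> x" "\<And>x. 0 \<le> \<sigma> x"
    and fin: "\<And>Q. Q \<in> F \<Longrightarrow> emeasure S Q \<noteq> \<infinity>" "\<And>Q. Q \<in> F \<Longrightarrow> emeasure H Q \<noteq> \<infinity>"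
    and W: "(\<integral>\<^sup>+x. ennreal (h x powr p * \<sigma> x powr (1 - p)) \<partial>M) \<le> ennreal W" "0 \<le> W"
    and E: "\<And>Q. Q \<in> F \<Longrightarrow> E Q \<in> sets M" "\<And>Q. Q \<in> F \<Longrightarrow> E Q \<subseteq> Q" "disjoint_family_on E F"
  shows "(\<Sum>Q\<in>F. (measure H Q / measure S Q) powr p * measure S (E Q)) \<le> (2 * (p / (p - 1))) powr p * W"
proof -
  define K where "K = density M (\<lambda>x. ennreal (h x powr p * \<sigma> x powr (1 - p)))"
  define c where "c Q = measure H Q / measure S Q" for Q
  define p' where "p' = p / (p - 1)"
  have sets [simp]: "sets S = sets M" "sets H = sets M" "sets K = sets M"
    by (auto simp: S_def H_def K_def)
  have c0: "0 \<le> c Q" for Q by (simp add: c_def)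
  have c: "c Q * measure S Q \<le> measure H Q" for Q by (simp add: c_def)
  obtain G where G: "\<And>Q. Q \<in> F \<Longrightarrow> G Q \<in> sets M" "\<And>Q. Q \<in> F \<Longrightarrow> G Q \<subseteq> Q" "disjoint_family_on G F"
      "\<And>Q x. Q \<in> F \<Longrightarrow> x \<in> Q \<Longrightarrow> \<exists>R\<in>F. x \<in> G R \<and> c Q \<le> c R"
    by (rule maximal_selection[OF F(1,3), of c]) (rule that)
  have finG: "emeasure S (G Q) \<noteq> \<infinity>" if "Q \<in> F" for Q
    using emeasure_mono[OF G(2)[OF that], of S] fin(1)[OF that] F(3) that by (auto simp: top_unique)
  have Kle: "emeasure K A \<le> ennreal W" if "A \<in> sets M" for A
  proof -
    have "emeasure K A \<le> emeasure K (space M)"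
      using that sets.sets_into_space by (intro emeasure_mono) auto
    also have "\<dots> \<le> ennreal W"
      using W(1) unfolding K_def by (subst emeasure_density) (auto intro: order_trans[OF nn_integral_mono])
    finally show ?thesis .
  qed
  have finK: "emeasure K A \<noteq> \<infinity>" if "A \<in> sets M" for A
    using Kle[OF that] by (auto simp: top_unique)
  define D where "D = (\<Sum>Q\<in>F. measure S (G Q) * c Q powr p)"
  have "D \<le> p / (p - 1) * (\<Sum>Q\<in>F. measure H (G Q) * c Q powr (p - 1))"
    unfolding D_def
  proof (rule layer_cake_sum)
    fix l :: real assume "0 < l"
    then show "l powr 1 * (\<Sum>Q | Q \<in> F \<and> l \<le> c Q. measure S (G Q)) \<le> (\<Sum>Q | Q \<in> F \<and> l \<le> c Q. measure H (G Q))"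
      using laminar_selection_weak_type[of F S H c G l] F fin c G by simp
  qed (use F p c0 in auto)
  also have "\<dots> = (\<Sum>Q\<in>F. p' * c Q powr (p - 1) * measure H (G Q))"
    by (simp add: p'_def sum_distrib_left mult_ac)
  also have "\<dots> \<le> (\<Sum>Q\<in>F. c Q powr p / 2 * measure S (G Q) + (2 * p') powr p / 2 * measure K (G Q))"
  proof (rule sum_mono)
    fix Q assume Q: "Q \<in> F"
    \<comment> \<open>The two terms of the Young-type bound are indexed by \<open>bool\<close> to
      fit the sum in \<open>measure_density_le_sum\<close>.\<close>
    define k where "k b = (if b then \<sigma> else (\<lambda>x. h x powr p * \<sigma> x powr (1 - p)))" for b
    define d where "d b = (if b then c Q powr p / 2 else (2 * p') powr p / 2)" for b
    have "p' * c Q powr (p - 1) * measure (density M (\<lambda>x. ennreal (h x))) (G Q)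
        \<le> (\<Sum>b\<in>UNIV. d b * measure (density M (\<lambda>x. ennreal (k b x))) (G Q))"
    proof (rule measure_density_le_sum)
      show "AE x in M. x \<in> G Q \<longrightarrow> p' * c Q powr (p - 1) * h x \<le> (\<Sum>b\<in>UNIV. d b * k b x)"
        using \<sigma>(1)
      proof eventually_elim
        case (elim x)
        then show ?case
          using young_absorption[OF p c0 h elim, of Q x]
          by (auto simp: d_def k_def UNIV_bool p'_def)
      qed
      show "emeasure (density M (\<lambda>x. ennreal (k b x))) (G Q) \<noteq> \<infinity>" for b
        using finG[OF Q] finK[OF G(1)[OF Q]] by (auto simp: k_def S_def K_def)
    qed (use \<sigma> h p G(1)[OF Q] in \<open>auto simp: k_def d_def p'_def\<close>)
    then show "p' * c Q powr (p - 1) * measure H (G Q)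
        \<le> c Q powr p / 2 * measure S (G Q) + (2 * p') powr p / 2 * measure K (G Q)"
      by (simp add: H_def S_def K_def k_def d_def UNIV_bool)
  qed
  also have "\<dots> = D / 2 + (2 * p') powr p / 2 * (\<Sum>Q\<in>F. measure K (G Q))"
    by (simp add: D_def sum.distrib sum_distrib_left sum_distrib_right sum_divide_distrib mult_ac)
  also have "(\<Sum>Q\<in>F. measure K (G Q)) = measure K (\<Union>Q\<in>F. G Q)"
    using F G finK by (intro measure_finite_Union[symmetric]) auto
  also have "\<dots> \<le> W"
    using Kle[OF sets.finite_UN[OF F(1) G(1)]] W(2) by (auto simp: measure_def intro!: enn2real_leI)
  \<comment> \<open>\<open>D\<close> is a finite real sum, so \<open>D / 2\<close> may be subtracted
    from both sides.\<close>
  finally have D: "D \<le> (2 * p') powr p * W"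
    by (simp add: mult_left_mono)
  \<comment> \<open>The maximal selection \<open>G\<close> dominates any other disjoint selection
    \<open>E\<close>: at each level the sets \<open>E Q\<close> lie in the superlevel set that the
    sets \<open>G Q\<close> fill. This is the layer cake with \<open>r = 0\<close>.\<close>
  have "(\<Sum>Q\<in>F. measure S (E Q) * c Q powr p) \<le> p / (p - 0) * (\<Sum>Q\<in>F. measure S (G Q) * c Q powr (p - 0))"
  proof (rule layer_cake_sum)
    fix l :: real assume "0 < l"
    let ?F = "{Q \<in> F. l \<le> c Q}"
    have finE: "emeasure S (E Q) \<noteq> \<infinity>" if "Q \<in> F" for Q
      using emeasure_mono[OF E(2)[OF that], of S] fin(1)[OF that] F(3) that by (auto simp: top_unique)
    have "(\<Sum>Q\<in>?F. measure S (E Q)) = measure S (\<Union>Q\<in>?F. E Q)"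
      using F E finE by (intro measure_finite_Union[symmetric])
        (auto intro: disjoint_family_on_mono[of _ F])
    also have "\<dots> \<le> measure S (\<Union>?F)"
    proof (rule measure_mono_fmeasurable)
      have "emeasure S (\<Union>?F) \<le> (\<Sum>Q\<in>?F. emeasure S Q)"
        using F emeasure_subadditive_finite[of ?F id S] by (simp add: subset_eq)
      also have "\<dots> < \<infinity>" using F fin(1) by (auto simp: less_top)
      finally show "\<Union>?F \<in> fmeasurable S"
        using F by (auto simp: fmeasurable_def)
    qed (use E F in \<open>auto\<close>)
    also have "\<dots> = (\<Sum>Q\<in>?F. measure S (G Q))"
      using selection_superlevel[of F S G c l] F fin G by simp
    finally show "l powr 0 * (\<Sum>Q\<in>?F. measure S (E Q)) \<le> (\<Sum>Q\<in>?F. measure S (G Q))"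
      using \<open>0 < l\<close> by simp
  qed (use F p c0 in auto)
  also have "\<dots> = D" using p by (simp add: D_def)
  finally show ?thesis using D by (simp add: c_def p'_def mult.commute)
qed

section \<open>Shifted dyadic grids\<close>

text \<open>Standard dyadic cubes, translated by a third of the side length in the directions
  \<open>i \<in> J\<close>. The sign alternates with the level because
  \<open>2 * (1 / 3)\<close> is \<open>- 1 / 3\<close> modulo \<open>1\<close>; this makes consecutive levels nested.\<close>

definition grid_shift :: "'n set \<Rightarrow> int \<Rightarrow> 'n \<Rightarrow> int" where
  "grid_shift J k i = (if i \<in> J then if even k then 1 else - 1 else 0)"

text \<open>Larger \<open>k\<close> means a finer grid, of side \<open>1 / 2 powi k\<close>. Using
  the floor makes the cells half-open, so that each level partitions the space.\<close>

definition grid_index :: "'n set \<Rightarrow> int \<Rightarrow> real ^ 'n \<Rightarrow> int ^ 'n" where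
  "grid_index J k x = (\<chi> i. \<lfloor>2 powi k * x $ i - grid_shift J k i / 3\<rfloor>)"

definition grid_cell :: "'n set \<Rightarrow> int \<Rightarrow> int ^ 'n \<Rightarrow> (real ^ 'n) set" where
  "grid_cell J k j = {x. grid_index J k x = j}"

definition grid :: "'n set \<Rightarrow> (real ^ 'n) set set" where
  "grid J = {grid_cell J k j | k j. True}"

lemma countable_grid: "countable (grid J)"
proof -
  have "grid J = (\<lambda>(k, j). grid_cell J k j) ` UNIV"
    by (auto simp: grid_def)
  then show ?thesis by simp
qed

text \<open>Because the shift changes sign from one level to the next, the shifted coordinate at
  level \<open>k + 1\<close> is twice the one at level \<open>k\<close> plus the integer
  \<open>grid_shift J k i\<close>. Hence the fine index determines the coarse one, which is the
  nestedness of the grid.\<close>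

lemma grid_index_parent:
  "grid_index J k x $ i = (grid_index J (k + 1) x $ i - grid_shift J k i) div 2"
proof -
  let ?u = "\<lambda>k. 2 powi k * x $ i - grid_shift J k i / 3 :: real"
  have "?u (k + 1) - grid_shift J k i = ?u k * 2"
    by (auto simp: grid_shift_def power_int_add algebra_simps)
  then have "?u k = (?u (k + 1) - grid_shift J k i) / real_of_int 2" by simp
  also have "\<lfloor>\<dots>\<rfloor> = \<lfloor>?u (k + 1) - grid_shift J k i\<rfloor> div 2"
    by (rule floor_divide_real_eq_div) simp
  finally show ?thesis by (simp add: grid_index_def)
qed

lemma grid_index_ancestor:
  assumes "grid_index J k' x = grid_index J k' y" "k \<le> k'"
  shows "grid_index J k x = grid_index J k y"
  using assms(2,1)
proof (induction rule: int_le_induct)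
  case (step k)
  then show ?case
    using grid_index_parent[of J "k - 1"] by (simp add: vec_eq_iff)
qed

lemma laminar_grid: "laminar (grid J)"
proof -
  have *: "grid_cell J k' j' \<inter> grid_cell J k j = {} \<or> grid_cell J k' j' \<subseteq> grid_cell J k j"
    if "k \<le> k'" for k k' j j'
  proof (cases "grid_cell J k' j' \<inter> grid_cell J k j = {}")
    case False
    then obtain z where "grid_index J k' z = j'" "grid_index J k z = j"
      by (auto simp: grid_cell_def)
    then have "grid_index J k y = j" if "grid_index J k' y = j'" for y
      using grid_index_ancestor[OF _ \<open>k \<le> k'\<close>, of J y z] that by simp
    then show ?thesis by (auto simp: grid_cell_def)
  qed simp
  show ?thesis
    unfolding laminar_def
  proof (intro ballI)
    fix Q R assume "Q \<in> grid J" "R \<in> grid J"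
    then obtain k j k' j' where [simp]: "Q = grid_cell J k j" "R = grid_cell J k' j'"
      by (auto simp: grid_def)
    show "Q \<inter> R = {} \<or> Q \<subseteq> R \<or> R \<subseteq> Q"
      using *[of k k' j' j] *[of k' k j j'] by (cases "k \<le> k'") (simp_all add: Int_commute, argo+)
  qed
qed

section \<open>Cells as cubes and the one-third trick\<close>

lemma sum_Basis_nth [simp]: "(\<Sum>b\<in>(Basis :: (real ^ 'n) set). b $ i) = 1"
proof -
  have "(\<Sum>b\<in>(Basis :: (real ^ 'n) set). b $ i) = One \<bullet> axis i (1::real)"
    by (simp add: inner_axis)
  then show ?thesis by (simp add: axis_in_Basis_iff)
qed

lemma mem_cube_iff: "x \<in> cbox a (a + l *\<^sub>R One) \<longleftrightarrow> (\<forall>i. a $ i \<le> x $ i \<and> x $ i \<le> a $ i + l)"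
  for a :: "real ^ 'n"
  by (simp add: mem_box_cart)

lemma measure_cube:
  fixes a :: "real ^ 'n"
  assumes "0 \<le> l"
  shows "measure lebesgue (cbox a (a + l *\<^sub>R One)) = l ^ CARD('n)"
proof -
  have "cbox a (a + l *\<^sub>R One) \<noteq> {}"
    using assms mem_cube_iff[of a a l] by auto
  then show ?thesis by (simp add: content_cbox_cart)
qed

definition grid_corner :: "'n set \<Rightarrow> int \<Rightarrow> int ^ 'n \<Rightarrow> real ^ 'n" where
  "grid_corner J k j = (\<chi> i. (j $ i + grid_shift J k i / 3) / 2 powi k)"

lemma mem_grid_cell_iff:
  "x \<in> grid_cell J k j \<longleftrightarrow>
    (\<forall>i. grid_corner J k j $ i \<le> x $ i \<and> x $ i < grid_corner J k j $ i + 1 / 2 powi k)"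
proof -
  have "\<lfloor>2 powi k * t - s / 3\<rfloor> = j \<longleftrightarrow> (j + s / 3) / 2 powi k \<le> t \<and> t < (j + s / 3) / 2 powi k + 1 / 2 powi k"
    for t s :: real and j :: int
  proof -
    have pos: "0 < (2::real) powi k" by simp
    have "(j + s / 3) / 2 powi k \<le> t \<longleftrightarrow> j \<le> 2 powi k * t - s / 3"
      by (subst pos_divide_le_eq[OF pos]) (auto simp: mult.commute)
    moreover have "t < (j + s / 3) / 2 powi k + 1 / 2 powi k \<longleftrightarrow> 2 powi k * t - s / 3 < j + 1"
      unfolding add_divide_distrib[symmetric]
      by (subst pos_less_divide_eq[OF pos]) (auto simp: mult.commute)
    ultimately show ?thesis by (simp add: floor_eq_iff)
  qed
  then show ?thesis
    by (simp add: grid_cell_def grid_index_def grid_corner_def vec_eq_iff)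
qed

lemma grid_cube:
  fixes Q :: "(real ^ 'n::finite) set"
  assumes "Q \<in> grid J"
  obtains a l where "0 < l" "box a (a + l *\<^sub>R One) \<subseteq> Q" "Q \<subseteq> cbox a (a + l *\<^sub>R One)"
    "closure Q = cbox a (a + l *\<^sub>R One)"
proof -
  obtain k j where Q: "Q = grid_cell J k j" using assms by (auto simp: grid_def)
  let ?a = "grid_corner J k j" and ?l = "1 / 2 powi k :: real"
  let ?b = "?a + ?l *\<^sub>R One"
  have pos: "0 < ?l" by simp
  have 1: "box ?a ?b \<subseteq> Q" "Q \<subseteq> cbox ?a ?b"
    by (auto simp: Q mem_grid_cell_iff mem_box_cart less_imp_le)
  have "box ?a ?b \<noteq> {}"
    by (simp add: interval_eq_empty_cart not_le)
  then have "closure Q = cbox ?a ?b"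
    using closure_mono[OF 1(1)] closure_minimal[OF 1(2)] closed_cbox by (auto simp: closure_box)
  then show ?thesis by (rule that[OF pos 1])
qed

text \<open>If both floors changed, the interval from \<open>t\<close> to \<open>t + h\<close> would
  contain an integer and a point of the integers shifted by \<open>s / 3\<close>. Their distance is
  less than 1/3, yet it is \<open>\<bar>z + s / 3\<bar>\<close> for an integer \<open>z\<close>,
  which forces \<open>3 * z + s = 0\<close>, impossible for \<open>s = 1\<close> or
  \<open>s = - 1\<close>.\<close>

lemma floor_third_shift:
  fixes s :: int and t h :: real
  assumes s: "s = 1 \<or> s = - 1" and h: "0 < h" "h < 1 / 3" and "\<lfloor>t\<rfloor> \<noteq> \<lfloor>t + h\<rfloor>"
  shows "\<lfloor>t + h - s / 3\<rfloor> = \<lfloor>t - s / 3\<rfloor>"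
proof (rule ccontr)
  assume neq: "\<not> ?thesis"
  have floor_gt: "x < real_of_int \<lfloor>x + h\<rfloor>" if "\<lfloor>x\<rfloor> \<noteq> \<lfloor>x + h\<rfloor>" for x
  proof -
    have "\<lfloor>x\<rfloor> < \<lfloor>x + h\<rfloor>"
      using that floor_mono[of x "x + h"] h by linarith
    then show ?thesis by (simp add: floor_less_iff)
  qed
  have 1: "t < \<lfloor>t + h\<rfloor>" "\<lfloor>t + h\<rfloor> \<le> t + h"
    using floor_gt[of t] assms by auto
  have eq: "t + h - s / 3 = t - s / 3 + h" by simp
  have 2: "t - s / 3 < \<lfloor>t + h - s / 3\<rfloor>" "\<lfloor>t + h - s / 3\<rfloor> \<le> t + h - s / 3"
    using floor_gt[of "t - s / 3"] neq by (auto simp only: eq of_int_floor_le)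
  define z where "z = \<lfloor>t + h - s / 3\<rfloor> - \<lfloor>t + h\<rfloor>"
  have "real_of_int z + s / 3 < 1 / 3" "- 1 / 3 < real_of_int z + s / 3"
    using 1 2 h unfolding z_def of_int_diff by linarith+
  then have "real_of_int (3 * z + s) < 1" "- 1 < real_of_int (3 * z + s)"
    by simp_all
  then have "3 * z + s = 0" by linarith
  with s show False by presburger
qed

text \<open>In each direction the endpoints of the interval cannot be separated both by
  \<open>\<int>\<close> and by \<open>\<int> + 1 / 3\<close>, as its length is less than \<open>1 / 3\<close> in units of the grid.\<close>

lemma cube_subset_grid:
  fixes a :: "real ^ 'n::finite"
  assumes "0 < l"
  obtains J Q where "Q \<in> grid J" "cbox a (a + l *\<^sub>R One) \<subseteq> Q" "measure lebesgue (closure Q) \<le> (6 * l) ^ CARD('n)"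
proof -
  \<comment> \<open>The finest level whose cells have side strictly larger than
    \<open>3 * l\<close>. Since the next level fails, the side is at most \<open>6 * l\<close>,
    whence the 6 in the conclusion.\<close>
  define k where "k = \<lceil>log 2 (1 / (3 * l))\<rceil> - 1"
  have "real_of_int k < log 2 (1 / (3 * l))" "log 2 (1 / (3 * l)) \<le> real_of_int (k + 1)"
    unfolding k_def by linarith+
  moreover have "2 powr real_of_int k = (2::real) powi k" for k
    by (rule powr_real_of_int') auto
  ultimately have k: "2 powi k < 1 / (3 * l)" "1 / (3 * l) \<le> 2 * 2 powi k"
    using assms by (simp_all add: less_log_iff log_le_iff powr_add mult.commute)
  then have k: "2 powi k * l < 1 / 3" "1 / 2 powi k \<le> 6 * l"
    using assms by (simp_all add: field_simps)
  define t where "t i = 2 powi k * a $ i" for i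
  define h where "h = 2 powi k * l"
  have h: "0 < h" "h < 1 / 3" using k assms by (simp_all add: h_def)
  \<comment> \<open>The grid is shifted exactly in the directions in which the unshifted one
    separates the endpoints.\<close>
  define J where "J = {i. \<lfloor>t i\<rfloor> \<noteq> \<lfloor>t i + h\<rfloor>}"
  have eq: "\<lfloor>t i + h - grid_shift J k i / 3\<rfloor> = \<lfloor>t i - grid_shift J k i / 3\<rfloor>" for i
  proof (cases "i \<in> J")
    case True
    define s :: int where "s = (if even k then 1 else - 1)"
    have s: "s = 1 \<or> s = - 1" by (simp add: s_def)
    have "\<lfloor>t i + h - s / 3\<rfloor> = \<lfloor>t i - s / 3\<rfloor>"
      using True by (intro floor_third_shift[OF s h]) (simp add: J_def)
    then show ?thesis using True by (simp add: grid_shift_def s_def)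
  qed (simp add: J_def grid_shift_def)
  define Q where "Q = grid_cell J k (grid_index J k a)"
  have Q: "Q \<in> grid J" by (auto simp: Q_def grid_def)
  have sub: "cbox a (a + l *\<^sub>R One) \<subseteq> Q"
  proof
    fix x assume x: "x \<in> cbox a (a + l *\<^sub>R One)"
    have "\<lfloor>2 powi k * x $ i - grid_shift J k i / 3\<rfloor> = \<lfloor>t i - grid_shift J k i / 3\<rfloor>" for i
    proof (rule antisym)
      have ax: "a $ i \<le> x $ i" "x $ i \<le> a $ i + l" using x by (auto simp: mem_box_cart)
      have "t i \<le> 2 powi k * x $ i" unfolding t_def using ax by (intro mult_left_mono) auto
      then show "\<lfloor>t i - grid_shift J k i / 3\<rfloor> \<le> \<lfloor>2 powi k * x $ i - grid_shift J k i / 3\<rfloor>"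
        by (intro floor_mono) auto
      have "2 powi k * x $ i \<le> 2 powi k * (a $ i + l)" using ax by (intro mult_left_mono) auto
      then have "2 powi k * x $ i \<le> t i + h" unfolding t_def h_def by (simp add: distrib_left)
      then show "\<lfloor>2 powi k * x $ i - grid_shift J k i / 3\<rfloor> \<le> \<lfloor>t i - grid_shift J k i / 3\<rfloor>"
        unfolding eq[of i, symmetric] by (intro floor_mono) auto
    qed
    then show "x \<in> Q" by (simp add: Q_def grid_cell_def grid_index_def vec_eq_iff t_def)
  qed
  have "closure Q \<subseteq> cbox (grid_corner J k (grid_index J k a))
      (grid_corner J k (grid_index J k a) + (1 / 2 powi k) *\<^sub>R One)"
    by (intro closure_minimal) (auto simp: Q_def mem_grid_cell_iff mem_box_cart less_imp_le)
  moreover have "closure Q \<in> sets lebesgue"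
    by (simp add: borel_closed)
  ultimately have "measure lebesgue (closure Q) \<le> measure lebesgue (cbox (grid_corner J k (grid_index J k a))
      (grid_corner J k (grid_index J k a) + (1 / 2 powi k) *\<^sub>R One))"
    by (intro measure_mono_fmeasurable) auto
  also have "\<dots> = (1 / 2 powi k) ^ CARD('n)" by (intro measure_cube) simp
  also have "\<dots> \<le> (6 * l) ^ CARD('n)" using k by (intro power_mono) auto
  finally show ?thesis using Q sub that by blast
qed

section \<open>The fractional maximal function\<close>

lemma epowr_ennreal [simp]: "0 \<le> x \<Longrightarrow> ennreal x epowr a = ennreal (x powr a)"
  by (simp add: epowr_def)

lemma epowr_mono: "x \<le> y \<Longrightarrow> 0 \<le> a \<Longrightarrow> x epowr a \<le> y epowr a"
  by (cases x; cases y) (auto simp: epowr_def top_unique intro!: powr_mono2)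

lemma epowr_epowr: "0 < a \<Longrightarrow> 0 < b \<Longrightarrow> (x epowr a) epowr b = x epowr (a * b)"
  by (cases x) (auto simp: epowr_def powr_powr)

lemma epowr_one [simp]: "x epowr 1 = x"
  by (cases x) (auto simp: epowr_def)

lemma epowr_mult: "0 < a \<Longrightarrow> 0 \<le> c \<Longrightarrow> (ennreal c * x) epowr a = ennreal (c powr a) * x epowr a"
  by (cases x; cases "c = 0") (auto simp: epowr_def powr_mult ennreal_mult_top simp flip: ennreal_mult)

lemma epowr_le_iff: "0 < a \<Longrightarrow> x epowr a \<le> y \<longleftrightarrow> x \<le> y epowr (1 / a)"
  using epowr_mono[of "x epowr a" y "1 / a"] epowr_mono[of x "y epowr (1 / a)" a]
  by (auto simp: epowr_epowr)

lemma borel_measurable_epowr [measurable]: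
  assumes [measurable]: "f \<in> borel_measurable M"
  shows "(\<lambda>x. f x epowr a) \<in> borel_measurable M"
  unfolding epowr_def by measurable

text \<open>Convexity of the exponential at the points \<open>ln (y i)\<close>. A vanishing
  \<open>y i\<close> is treated first, as it has no useful logarithm; the product is then 0.\<close>

lemma prod_powr_le_weighted_sum:
  fixes y t :: "'i \<Rightarrow> real"
  assumes "finite I" "\<And>i. i \<in> I \<Longrightarrow> 0 \<le> y i" "\<And>i. i \<in> I \<Longrightarrow> 0 < t i" "(\<Sum>i\<in>I. t i) = 1"
  shows "(\<Prod>i\<in>I. y i powr t i) \<le> (\<Sum>i\<in>I. t i * y i)"
proof (cases "\<exists>i\<in>I. y i = 0")
  case True
  then have "(\<Prod>i\<in>I. y i powr t i) = 0" using assms(1) by (intro prod_zero) auto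
  moreover have "0 \<le> (\<Sum>i\<in>I. t i * y i)"
    using assms by (intro sum_nonneg mult_nonneg_nonneg) (auto simp: less_imp_le)
  ultimately show ?thesis by simp
next
  case False
  then have pos: "0 < y i" if "i \<in> I" for i using assms(2) that by (metis less_eq_real_def)
  have "I \<noteq> {}" using assms(4) by auto
  have "(\<Prod>i\<in>I. y i powr t i) = exp (\<Sum>i\<in>I. t i *\<^sub>R ln (y i))"
    unfolding exp_sum[OF assms(1)]
  proof (rule prod.cong[OF refl])
    show "y i powr t i = exp (t i *\<^sub>R ln (y i))" if "i \<in> I" for i
      using pos[OF that] by (simp add: powr_def)
  qed
  also have "\<dots> \<le> (\<Sum>i\<in>I. t i * exp (ln (y i)))"
    using assms \<open>I \<noteq> {}\<close> convex_on_sum[OF assms(1) _ exp_convex, of t "\<lambda>i. ln (y i)"]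
    by (simp add: less_imp_le)
  finally show ?thesis using pos by simp
qed

lemma disjoint_family_sum_indicator_le:
  fixes a :: "'i \<Rightarrow> ennreal"
  assumes "finite F" "disjoint_family_on E F" "\<And>Q. Q \<in> F \<Longrightarrow> x \<in> E Q \<Longrightarrow> a Q \<le> y"
  shows "(\<Sum>Q\<in>F. a Q * indicator (E Q) x) \<le> y"
proof (cases "\<exists>Q\<in>F. x \<in> E Q")
  case True
  then obtain Q where Q: "Q \<in> F" "x \<in> E Q" by blast
  then have "x \<notin> E R" if "R \<in> F" "R \<noteq> Q" for R
    using assms(2) that by (auto simp: disjoint_family_on_def)
  then have "(\<Sum>Q\<in>F. a Q * indicator (E Q) x) = (\<Sum>R\<in>{Q}. a R * indicator (E R) x)"
    using Q assms(1) by (intro sum.mono_neutral_right) auto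
  then show ?thesis using Q assms(3) by simp
qed auto

section \<open>Averages over cubes\<close>

definition mass :: "('a::euclidean_space \<Rightarrow> real) \<Rightarrow> 'a set \<Rightarrow> real" where
  "mass f Q = measure (density lebesgue (\<lambda>x. ennreal \<bar>f x\<bar>)) Q"

text \<open>\<open>mass\<close> is real-valued and takes the value 0 where the integral is infinite;
  this condition ensures that it is the true integral over cubes.\<close>

definition cube_integrable :: "(real ^ 'n \<Rightarrow> real) \<Rightarrow> bool" where
  "cube_integrable f \<longleftrightarrow> f \<in> borel_measurable lebesgue \<and>
     (\<forall>Q\<in>cubes. emeasure (density lebesgue (\<lambda>x. ennreal \<bar>f x\<bar>)) Q \<noteq> \<infinity>)"

text \<open>The exponent merges the fractional factor with the \<open>m\<close> normalisations of
  the averages.\<close>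

definition frac_avg :: "nat \<Rightarrow> real \<Rightarrow> (nat \<Rightarrow> real ^ 'n \<Rightarrow> real) \<Rightarrow> (real ^ 'n) set \<Rightarrow> real" where
  "frac_avg m \<alpha> f Q = measure lebesgue Q powr (\<alpha> / real CARD('n) - real m) * (\<Prod>i = 1..m. mass (f i) Q)"

lemma cubes_sets [measurable]: "Q \<in> cubes \<Longrightarrow> Q \<in> sets lebesgue"
  by (auto simp: cubes_def)

lemma cubesE:
  fixes Q :: "(real ^ 'n) set"
  assumes "Q \<in> cubes"
  obtains a l where "0 < l" "Q = cbox a (a + l *\<^sub>R One)" "measure lebesgue Q = l ^ CARD('n)"
    "emeasure lebesgue Q = ennreal (measure lebesgue Q)" "0 < measure lebesgue Q"
proof -
  obtain a :: "real ^ 'n" and l where l: "0 < l" "Q = cbox a (a + l *\<^sub>R One)"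
    using assms by (auto simp: cubes_def)
  moreover have "measure lebesgue Q = l ^ CARD('n)"
    using l by (simp only: measure_cube less_imp_le)
  moreover have "emeasure lebesgue Q = ennreal (measure lebesgue Q)"
    unfolding l(2) by (intro emeasure_eq_ennreal_measure) (simp add: emeasure_lborel_cbox_eq)
  ultimately show ?thesis by (intro that) auto
qed

lemma mass_nonneg [simp]: "0 \<le> mass f Q"
  by (simp add: mass_def)

lemma frac_avg_nonneg [simp]: "0 \<le> frac_avg m \<alpha> f Q"
  by (simp add: frac_avg_def prod_nonneg)

lemma frac_maximal_eq:
  fixes f :: "nat \<Rightarrow> real ^ 'n \<Rightarrow> real"
  assumes "1 \<le> m" and f: "\<And>i. i \<in> {1..m} \<Longrightarrow> cube_integrable (f i)"
  shows "frac_maximal m \<alpha> f x = (SUP Q\<in>cubes. ennreal (frac_avg m \<alpha> f Q) * indicator Q x)"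
  unfolding frac_maximal_def
proof (rule SUP_cong[OF refl])
  fix Q :: "(real ^ 'n) set" assume Q: "Q \<in> cubes"
  define L where "L = measure lebesgue Q"
  from Q have L: "emeasure lebesgue Q = ennreal L" "0 < L"
    unfolding L_def by (auto elim: cubesE)
  show "emeasure lebesgue Q epowr (\<alpha> / real CARD('n)) * (\<Prod>i = 1..m. indicator Q x / emeasure lebesgue Q *
     (\<integral>\<^sup>+y\<in>Q. ennreal \<bar>f i y\<bar> \<partial>lebesgue)) = ennreal (frac_avg m \<alpha> f Q) * indicator Q x"
  proof (cases "x \<in> Q")
    case True
    have "indicator Q x / emeasure lebesgue Q * (\<integral>\<^sup>+y\<in>Q. ennreal \<bar>f i y\<bar> \<partial>lebesgue) = ennreal (mass (f i) Q / L)"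
      if "i \<in> {1..m}" for i
    proof -
      have [measurable]: "f i \<in> borel_measurable lebesgue" using f[OF that] by (simp add: cube_integrable_def)
      have "(\<integral>\<^sup>+y\<in>Q. ennreal \<bar>f i y\<bar> \<partial>lebesgue) = emeasure (density lebesgue (\<lambda>x. ennreal \<bar>f i x\<bar>)) Q"
        using Q by (simp add: emeasure_density cubes_sets)
      also have "\<dots> = ennreal (mass (f i) Q)"
        using f[OF that] Q unfolding mass_def by (intro emeasure_eq_ennreal_measure) (auto simp: cube_integrable_def)
      finally have "(\<integral>\<^sup>+y\<in>Q. ennreal \<bar>f i y\<bar> \<partial>lebesgue) = ennreal (mass (f i) Q)" .
      then show ?thesis
        using True L by (simp add: divide_ennreal_def inverse_ennreal field_simps flip: ennreal_mult)
    qed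
    then show ?thesis
      using True L by (simp add: frac_avg_def L_def[symmetric] prod_ennreal prod_dividef prod_nonneg
          powr_diff powr_realpow flip: ennreal_mult)
  next
    case False
    \<comment> \<open>As \<open>1 \<le> m\<close>, the product has a factor, and the indicator makes
      it vanish off \<open>Q\<close>.\<close>
    then show ?thesis using assms(1) by (simp add: prod_zero_iff)
  qed
qed

lemma frac_maximal_ge:
  assumes "1 \<le> m" "\<And>i. i \<in> {1..m} \<Longrightarrow> cube_integrable (f i)" "Q \<in> cubes" "x \<in> Q"
  shows "ennreal (frac_avg m \<alpha> f Q) \<le> frac_maximal m \<alpha> f x"
proof -
  have "ennreal (frac_avg m \<alpha> f Q) * indicator Q x \<le> frac_maximal m \<alpha> f x"
    by (subst frac_maximal_eq) (use assms in \<open>auto intro!: SUP_upper2[of Q]\<close>)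
  then show ?thesis using assms(4) by simp
qed

lemma frac_maximal_le:
  assumes "1 \<le> m" "\<And>i. i \<in> {1..m} \<Longrightarrow> cube_integrable (f i)"
    and "\<And>Q. Q \<in> cubes \<Longrightarrow> x \<in> Q \<Longrightarrow> ennreal (frac_avg m \<alpha> f Q) \<le> y"
  shows "frac_maximal m \<alpha> f x \<le> y"
  using assms by (subst frac_maximal_eq) (auto simp: indicator_def intro!: SUP_least)

lemma mass_mono:
  assumes "cube_integrable f" "R \<in> cubes" "Q \<subseteq> R" "Q \<in> sets lebesgue"
  shows "mass f Q \<le> mass f R"
  using assms cubes_sets[of R] unfolding mass_def
  by (intro measure_mono_fmeasurable) (auto simp: fmeasurable_def cube_integrable_def less_top)

text \<open>The superlevel sets are open because the average over a slightly enlarged cube is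
  almost as large.\<close>

lemma borel_measurable_frac_maximal:
  fixes f :: "nat \<Rightarrow> real ^ 'n \<Rightarrow> real"
  assumes m: "1 \<le> m" and f: "\<And>i. i \<in> {1..m} \<Longrightarrow> cube_integrable (f i)"
  shows "frac_maximal m \<alpha> f \<in> borel_measurable lebesgue"
proof (rule borel_measurableI_greater)
  fix y
  let ?S = "{x. y < frac_maximal m \<alpha> f x}"
  have "\<exists>T. open T \<and> x \<in> T \<and> T \<subseteq> ?S" if "x \<in> ?S" for x
  proof -
    from that have "y < (SUP Q\<in>cubes. ennreal (frac_avg m \<alpha> f Q) * indicator Q x)"
      using frac_maximal_eq[OF m, of f \<alpha> x] f by simp
    then obtain Q where "Q \<in> cubes" and y: "y < ennreal (frac_avg m \<alpha> f Q) * indicator Q x"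
      by (auto simp: less_SUP_iff)
    from y have x: "x \<in> Q" by (cases "x \<in> Q") auto
    with y have y: "y < ennreal (frac_avg m \<alpha> f Q)" by simp
    obtain a l where l: "0 < l" "Q = cbox a (a + l *\<^sub>R One)" "measure lebesgue Q = l ^ CARD('n)"
      using \<open>Q \<in> cubes\<close> by (rule cubesE)
    \<comment> \<open>Volume of the cube enlarged by \<open>t\<close> on every side, but masses over
      \<open>Q\<close> itself: this is continuous at 0 and bounds the average over the enlarged cube
      from below. The interior of that cube contains \<open>Q\<close> and lies in the superlevel
      set.\<close>
    define g where "g t = ((l + 2 * t) ^ CARD('n)) powr (\<alpha> / real CARD('n) - real m) * (\<Prod>i = 1..m. mass (f i) Q)" for t
    have "((\<lambda>t. ennreal (g t)) \<longlongrightarrow> ennreal (g 0)) (at_right 0)"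
      unfolding g_def using l(1) by (intro tendsto_ennrealI tendsto_intros) auto
    moreover have "g 0 = frac_avg m \<alpha> f Q" by (simp add: g_def frac_avg_def l(3))
    ultimately have "\<forall>\<^sub>F t in at_right 0. y < ennreal (g t)"
      using y by (auto intro: order_tendstoD)
    moreover have "\<forall>\<^sub>F t in at_right 0. 0 < (t::real)"
      by (rule eventually_at_right_less)
    ultimately have "\<forall>\<^sub>F t in at_right 0. 0 < t \<and> y < ennreal (g t)"
      by eventually_elim simp
    then obtain t where t: "0 < t" "y < ennreal (g t)"
      using eventually_happens[of _ "at_right (0::real)"] by auto
    define R where "R = cbox (a - t *\<^sub>R One) ((a - t *\<^sub>R One) + (l + 2 * t) *\<^sub>R One)"
    define T where "T = box (a - t *\<^sub>R One) ((a - t *\<^sub>R One) + (l + 2 * t) *\<^sub>R One)"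
    have R: "R \<in> cubes" unfolding R_def cubes_def using l(1) t(1)
      by (intro CollectI exI[of _ "a - t *\<^sub>R One"] exI[of _ "l + 2 * t"]) auto
    have xT: "Q \<subseteq> T"
    proof
      fix z assume "z \<in> Q"
      then have "a $ i \<le> z $ i \<and> z $ i \<le> a $ i + l" for i
        unfolding l(2) by (simp add: mem_box_cart)
      then have "a $ i - t < z $ i \<and> z $ i < a $ i - t + (l + 2 * t)" for i
        using t(1) by (smt (verit))
      then show "z \<in> T" unfolding T_def by (simp add: mem_box_cart)
    qed
    have TR: "T \<subseteq> R" unfolding T_def R_def by (rule box_subset_cbox)
    have "g t \<le> frac_avg m \<alpha> f R"
      unfolding g_def frac_avg_def
    proof (intro mult_mono prod_mono conjI)
      have "measure lebesgue R = (l + 2 * t) ^ CARD('n)"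
        unfolding R_def using l(1) t(1) by (intro measure_cube) auto
      then show "((l + 2 * t) ^ CARD('n)) powr (\<alpha> / real CARD('n) - real m) \<le> measure lebesgue R powr (\<alpha> / real CARD('n) - real m)"
        by simp
      show "mass (f i) Q \<le> mass (f i) R" if "i \<in> {1..m}" for i
        using xT TR by (intro mass_mono f that R cubes_sets \<open>Q \<in> cubes\<close>) (rule subset_trans)
    qed (auto intro!: prod_nonneg)
    then have "y < ennreal (frac_avg m \<alpha> f R)"
      by (rule less_le_trans[OF t(2) ennreal_leI])
    have "T \<subseteq> ?S"
    proof
      fix z assume "z \<in> T"
      note \<open>y < ennreal (frac_avg m \<alpha> f R)\<close>
      also have "ennreal (frac_avg m \<alpha> f R) \<le> frac_maximal m \<alpha> f z"
        using f R subsetD[OF TR \<open>z \<in> T\<close>] by (rule frac_maximal_ge[OF m])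
      finally show "z \<in> ?S" by simp
    qed
    then show ?thesis
      using x xT by (intro exI[of _ T]) (auto simp: T_def)
  qed
  then have "open ?S" by (subst open_subopen) blast
  then show "{x \<in> space lebesgue. y < frac_maximal m \<alpha> f x} \<in> sets lebesgue"
    by (simp add: borel_open)
qed

section \<open>Grid cells and closed cubes\<close>

lemma grid_closure:
  fixes Q :: "(real ^ 'n::finite) set"
  assumes "Q \<in> grid J"
  shows "closure Q \<in> cubes" "Q \<in> sets lebesgue" "AE x in lebesgue. x \<in> closure Q \<longleftrightarrow> x \<in> Q"
proof -
  obtain a l where l: "0 < l" "box a (a + l *\<^sub>R One) \<subseteq> Q" "Q \<subseteq> cbox a (a + l *\<^sub>R One)"
    "closure Q = cbox a (a + l *\<^sub>R One)"
    using assms by (rule grid_cube)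
  show "closure Q \<in> cubes" using l by (auto simp: cubes_def)
  have "closure Q - Q \<subseteq> cbox a (a + l *\<^sub>R One) - box a (a + l *\<^sub>R One)"
    using l by auto
  then have "negligible (closure Q - Q)"
    using negligible_frontier_interval negligible_subset by blast
  then have null: "closure Q - Q \<in> null_sets lebesgue"
    by (simp add: negligible_iff_null_sets)
  then have "AE x in lebesgue. x \<notin> closure Q - Q" by (rule AE_not_in)
  then show "AE x in lebesgue. x \<in> closure Q \<longleftrightarrow> x \<in> Q"
    by eventually_elim (use closure_subset[of Q] in blast)
  have "Q = closure Q - (closure Q - Q)" using closure_subset[of Q] by blast
  also have "\<dots> \<in> sets lebesgue" using null by (auto simp: borel_closed)
  finally show "Q \<in> sets lebesgue" .
qed

text \<open>Laminarity needs half-open cells, while the maximal function is defined by closed cubes.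
  The two differ by a null set, so passing between them changes no average.\<close>

lemma emeasure_density_closure_grid:
  assumes "Q \<in> grid J" "g \<in> borel_measurable lebesgue"
  shows "emeasure (density lebesgue g) (closure Q) = emeasure (density lebesgue g) Q"
  using assms grid_closure[OF assms(1)] cubes_sets
  by (auto simp: emeasure_density indicator_def intro!: nn_integral_cong_AE elim: AE_mp)

lemma measure_closure_grid:
  assumes "Q \<in> grid J"
  shows "measure lebesgue (closure Q) = measure lebesgue Q"
  using emeasure_density_closure_grid[OF assms, of "\<lambda>_. 1"] by (simp add: density_1 measure_def)

lemma mass_closure_grid:
  assumes "Q \<in> grid J" "cube_integrable f"
  shows "mass f (closure Q) = mass f Q"
proof -
  have [measurable]: "f \<in> borel_measurable lebesgue" using assms(2) by (simp add: cube_integrable_def)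
  show ?thesis by (simp add: mass_def measure_def emeasure_density_closure_grid[OF assms(1)])
qed

lemma frac_avg_closure_grid:
  assumes "Q \<in> grid J" "\<And>i. i \<in> {1..m} \<Longrightarrow> cube_integrable (f i)"
  shows "frac_avg m \<alpha> f (closure Q) = frac_avg m \<alpha> f Q"
  unfolding frac_avg_def measure_closure_grid[OF assms(1)] using assms by (simp add: mass_closure_grid)

section \<open>Weights\<close>

text \<open>Local integrability gives measurability of the restrictions to balls, and the weight is
  their pointwise limit.\<close>

lemma weight_measurable:
  fixes w :: "real ^ 'n \<Rightarrow> real"
  assumes "weight w"
  shows "w \<in> borel_measurable lebesgue"
proof (rule borel_measurable_LIMSEQ_real)
  show "(\<lambda>x. indicator (cball 0 (real n)) x *\<^sub>R w x) \<in> borel_measurable lebesgue" for n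
    using assms compact_cball by (intro borel_measurable_integrable) (auto simp: weight_def set_integrable_def)
  show "(\<lambda>n. indicator (cball 0 (real n)) x *\<^sub>R w x) \<longlonglongrightarrow> w x" for x
  proof (rule tendsto_eventually)
    obtain N where "norm x \<le> real N" using real_arch_simple by blast
    then have "\<forall>\<^sub>F n in sequentially. norm x \<le> real n"
      by (intro eventually_sequentiallyI[of N]) linarith
    then show "\<forall>\<^sub>F n in sequentially. indicator (cball 0 (real n)) x *\<^sub>R w x = w x"
      by eventually_elim simp
  qed
qed

lemma weight_cube_integrable:
  fixes w :: "real ^ 'n \<Rightarrow> real"
  assumes "weight w"
  shows "cube_integrable w"
  unfolding cube_integrable_def
proof (intro conjI ballI)
  note [measurable] = weight_measurable[OF assms]
  show "w \<in> borel_measurable lebesgue" by measurable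
  fix Q :: "(real ^ 'n) set" assume Q: "Q \<in> cubes"
  then have "compact Q" by (auto simp: cubes_def)
  then have "integrable lebesgue (\<lambda>x. indicator Q x *\<^sub>R w x)"
    using assms by (auto simp: weight_def set_integrable_def)
  then have "(\<integral>\<^sup>+x. ennreal (norm (indicator Q x *\<^sub>R w x)) \<partial>lebesgue) < \<infinity>"
    by (simp add: integrable_iff_bounded)
  also have "(\<integral>\<^sup>+x. ennreal (norm (indicator Q x *\<^sub>R w x)) \<partial>lebesgue)
      = emeasure (density lebesgue (\<lambda>x. ennreal \<bar>w x\<bar>)) Q"
    using cubes_sets[OF Q] by (subst emeasure_density) (auto intro!: nn_integral_cong simp: indicator_def)
  finally show "emeasure (density lebesgue (\<lambda>x. ennreal \<bar>w x\<bar>)) Q \<noteq> \<infinity>" by simp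
qed

lemma mass_pos:
  fixes g :: "real ^ 'n \<Rightarrow> real"
  assumes g: "cube_integrable g" "AE x in lebesgue. g x > 0" and Q: "Q \<in> cubes"
  shows "0 < mass g Q"
proof (rule ccontr)
  have [measurable]: "g \<in> borel_measurable lebesgue" "Q \<in> sets lebesgue"
    using g Q by (auto simp: cube_integrable_def cubes_sets)
  assume "\<not> 0 < mass g Q"
  then have "mass g Q = 0" using mass_nonneg[of g Q] by simp
  then have "emeasure (density lebesgue (\<lambda>x. ennreal \<bar>g x\<bar>)) Q = 0"
    using g(1) Q by (simp add: mass_def cube_integrable_def measure_def enn2real_eq_0_iff)
  then have "AE x in lebesgue. ennreal \<bar>g x\<bar> * indicator Q x = 0"
    by (subst (asm) emeasure_density) (auto simp: nn_integral_0_iff_AE)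
  then have "AE x in lebesgue. x \<notin> Q"
    using g(2) by eventually_elim (auto simp: indicator_def split: if_splits)
  then have "emeasure lebesgue Q = 0"
    using AE_iff_measurable[of Q lebesgue "\<lambda>x. x \<notin> Q"] sets.sets_into_space[of Q lebesgue] by auto
  moreover obtain "emeasure lebesgue Q = ennreal (measure lebesgue Q)" "0 < measure lebesgue Q"
    using Q by (rule cubesE)
  ultimately show False by simp
qed

text \<open>A pointwise substitute for Hoelder's inequality. Let \<open>s\<close> be
  \<open>w x powr (1 - conj_exp p)\<close>, so that \<open>s powr (p - 1) = 1 / w x\<close>. Either
  \<open>\<bar>f x\<bar> \<le> s\<close>, or \<open>\<bar>f x\<bar> powr (p - 1) * w x\<close> is at
  least 1 and \<open>\<bar>f x\<bar>\<close> is at most \<open>\<bar>f x\<bar> powr p * w x\<close>.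
  Both bounds are integrable over cubes.\<close>

lemma cube_integrable_Lp:
  fixes f w :: "real ^ 'n \<Rightarrow> real"
  assumes p: "1 < p" and [measurable]: "f \<in> borel_measurable lebesgue" "w \<in> borel_measurable lebesgue"
    and w: "AE x in lebesgue. w x > 0" and \<sigma>: "cube_integrable (\<lambda>x. w x powr (1 - conj_exp p))"
    and fin: "(\<integral>\<^sup>+x. ennreal (\<bar>f x\<bar> powr p) * ennreal (w x) \<partial>lebesgue) < \<infinity>"
  shows "cube_integrable f"
  unfolding cube_integrable_def
proof (intro conjI ballI)
  show "f \<in> borel_measurable lebesgue" by measurable
  fix Q :: "(real ^ 'n) set" assume Q: "Q \<in> cubes"
  note [measurable] = cubes_sets[OF Q]
  let ?s = "\<lambda>x. w x powr (1 - conj_exp p)"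
  have "emeasure (density lebesgue (\<lambda>x. ennreal \<bar>f x\<bar>)) Q
      = (\<integral>\<^sup>+x. ennreal \<bar>f x\<bar> * indicator Q x \<partial>lebesgue)"
    by (simp add: emeasure_density)
  also have "\<dots> \<le> (\<integral>\<^sup>+x. ennreal (\<bar>f x\<bar> powr p) * ennreal (w x) + ennreal \<bar>?s x\<bar> * indicator Q x \<partial>lebesgue)"
  proof (rule nn_integral_mono_AE, use w in eventually_elim)
    case (elim x)
    have "\<bar>f x\<bar> \<le> \<bar>f x\<bar> powr p * w x" if "?s x < \<bar>f x\<bar>"
    proof -
      have "(1 - conj_exp p) * (p - 1) = - 1" using p by (simp add: conj_exp_def field_simps)
      then have "?s x powr (p - 1) = 1 / w x"
        using elim by (simp add: powr_powr powr_minus_divide)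
      moreover have "?s x powr (p - 1) \<le> \<bar>f x\<bar> powr (p - 1)"
        using that p by (intro powr_mono2) auto
      ultimately have "1 / w x \<le> \<bar>f x\<bar> powr (p - 1)" by simp
      then have 1: "1 \<le> \<bar>f x\<bar> powr (p - 1) * w x" using elim by (simp add: pos_divide_le_eq)
      have "0 < \<bar>f x\<bar>" using that powr_ge_zero[of "w x" "1 - conj_exp p"] by linarith
      then have "\<bar>f x\<bar> powr p = \<bar>f x\<bar> * \<bar>f x\<bar> powr (p - 1)" by (simp add: powr_diff)
      with 1 show ?thesis
        using mult_left_mono[of 1 "\<bar>f x\<bar> powr (p - 1) * w x" "\<bar>f x\<bar>"] by (simp add: mult.assoc)
    qed
    then have "\<bar>f x\<bar> \<le> \<bar>f x\<bar> powr p * w x + \<bar>?s x\<bar>"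
      using elim by (cases "?s x < \<bar>f x\<bar>") (auto intro: add_increasing2 add_increasing)
    then have "ennreal \<bar>f x\<bar> \<le> ennreal (\<bar>f x\<bar> powr p * w x + \<bar>?s x\<bar>)" by (rule ennreal_leI)
    then show ?case using elim by (auto simp: indicator_def ennreal_mult ennreal_plus)
  qed
  also have "\<dots> = (\<integral>\<^sup>+x. ennreal (\<bar>f x\<bar> powr p) * ennreal (w x) \<partial>lebesgue)
      + emeasure (density lebesgue (\<lambda>x. ennreal \<bar>?s x\<bar>)) Q"
    by (subst nn_integral_add) (auto simp: emeasure_density)
  also have "\<dots> < \<infinity>"
    using fin \<sigma> Q by (simp add: cube_integrable_def less_top)
  finally show "emeasure (density lebesgue (\<lambda>x. ennreal \<bar>f x\<bar>)) Q \<noteq> \<infinity>" by simp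
qed

section \<open>Estimates under the testing condition\<close>

lemma ennreal_le_mult_of_divide_le:
  assumes "x / ennreal c \<le> ennreal k" "0 < c" "0 \<le> k"
  shows "x \<le> ennreal k * ennreal c"
  using assms
  by (cases x) (auto simp: divide_ennreal ennreal_top_divide pos_divide_le_eq top_unique simp flip: ennreal_mult)

text \<open>The factor \<open>q / p\<close> and the outer power come from the Carleson embedding of
  order \<open>q / p\<close>, the weights \<open>p / P i\<close> from the arithmetic-geometric mean
  inequality, and the remaining powers from Doob's inequality.\<close>

definition embedding_factor :: "nat \<Rightarrow> real \<Rightarrow> real \<Rightarrow> (nat \<Rightarrow> real) \<Rightarrow> real" where
  "embedding_factor m p q P = q / p * (\<Sum>i = 1..m. p / P i * (2 * (P i / (P i - 1))) powr P i) powr (q / p)"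

locale sawyer_testing =
  fixes m :: nat and \<alpha> p q :: real and P :: "nat \<Rightarrow> real"
    and w :: "nat \<Rightarrow> real ^ 'n::finite \<Rightarrow> real" and v :: "real ^ 'n \<Rightarrow> real"
  assumes m: "1 \<le> m" and \<alpha>: "\<alpha> < real m * real CARD('n)" and P: "\<And>i. i \<in> {1..m} \<Longrightarrow> 1 < P i"
    and p_eq: "1 / p = (\<Sum>i = 1..m. 1 / P i)" and pq: "p \<le> q"
    and w: "\<And>i. i \<in> {1..m} \<Longrightarrow> weight (w i)" and v: "weight v"
    and dual: "\<And>i. i \<in> {1..m} \<Longrightarrow> weight (dual_weight P w i)"
    and testing: "sawyer_const m \<alpha> p P q w v < \<infinity>"
begin

abbreviation "\<sigma> \<equiv> dual_weight P w"
abbreviation "\<nu> \<equiv> nu_weight m p P w"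

definition K :: real where "K = enn2real (sawyer_const m \<alpha> p P q w v)"

definition V :: "(real ^ 'n) measure" where "V = density lebesgue (\<lambda>x. ennreal (v x))"

lemma p_pos: "0 < p"
proof -
  have "0 < (\<Sum>i = 1..m. 1 / P i)"
    using m P by (intro sum_pos) (auto intro: less_trans[OF zero_less_one])
  then have "0 < 1 / p" unfolding p_eq .
  then show ?thesis by simp
qed

lemma q_pos: "0 < q" using p_pos pq by simp

lemma exponents: "(\<Sum>i = 1..m. p / P i) = 1" "i \<in> {1..m} \<Longrightarrow> 0 < p / P i"
proof -
  have "(\<Sum>i = 1..m. p / P i) = p * (1 / p)"
    unfolding p_eq by (simp add: sum_distrib_left)
  then show "(\<Sum>i = 1..m. p / P i) = 1" using p_pos by simp
  show "0 < p / P i" if "i \<in> {1..m}" using P[OF that] p_pos by simp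
qed

lemma K_nonneg: "0 \<le> K" by (simp add: K_def)

lemma sets_V [simp, measurable_cong]: "sets V = sets lebesgue" by (simp add: V_def)

lemmas w_measurable = weight_measurable[OF w]
lemmas v_measurable [measurable] = weight_measurable[OF v]
lemmas dual_measurable = weight_measurable[OF dual]
lemmas dual_integrable = weight_cube_integrable[OF dual]

lemma dual_nonneg [simp]: "0 \<le> \<sigma> i x" by (simp add: dual_weight_def)

lemma nu_nonneg [simp]: "0 \<le> \<nu> x" by (simp add: nu_weight_def prod_nonneg)

lemma dual_pos: "AE x in lebesgue. \<forall>i\<in>{1..m}. 0 < \<sigma> i x"
  using dual by (intro AE_finite_allI) (auto simp: weight_def)

lemma nu_pos: "AE x in lebesgue. 0 < \<nu> x"
  using dual_pos by eventually_elim (auto simp: nu_weight_def intro!: prod_pos)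

text \<open>The arithmetic-geometric mean inequality with weights \<open>p / P i\<close>, each at
  most 1. It makes \<open>\<nu>\<close> integrable over cubes.\<close>

lemma nu_le: "\<nu> x \<le> (\<Sum>i = 1..m. \<sigma> i x)"
proof -
  have "\<nu> x \<le> (\<Sum>i = 1..m. p / P i * \<sigma> i x)"
    unfolding nu_weight_def using exponents by (intro prod_powr_le_weighted_sum) auto
  also have "\<dots> \<le> (\<Sum>i = 1..m. 1 * \<sigma> i x)"
  proof (intro sum_mono mult_right_mono)
    fix i assume i: "i \<in> {1..m}"
    have "p / P i \<le> (\<Sum>i = 1..m. p / P i)"
      using i exponents(2) by (intro member_le_sum) (auto simp: less_imp_le)
    then show "p / P i \<le> 1" by (simp only: exponents)
  qed simp
  finally show ?thesis by simp
qed

lemma nu_integrable: "cube_integrable \<nu>"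
  unfolding cube_integrable_def
proof (intro conjI ballI)
  show [measurable]: "\<nu> \<in> borel_measurable lebesgue"
    using dual_measurable unfolding nu_weight_def[abs_def] by measurable
  fix Q :: "(real ^ 'n) set" assume Q: "Q \<in> cubes"
  note [measurable] = cubes_sets[OF Q]
  have "emeasure (density lebesgue (\<lambda>x. ennreal \<bar>\<nu> x\<bar>)) Q = (\<integral>\<^sup>+x. ennreal (\<nu> x) * indicator Q x \<partial>lebesgue)"
    by (simp add: emeasure_density)
  also have "\<dots> \<le> (\<integral>\<^sup>+x. (\<Sum>i = 1..m. ennreal \<bar>\<sigma> i x\<bar> * indicator Q x) \<partial>lebesgue)"
    using nu_le by (intro nn_integral_mono)
      (auto simp: indicator_def sum_ennreal intro!: ennreal_leI)
  also have "\<dots> = (\<Sum>i = 1..m. emeasure (density lebesgue (\<lambda>x. ennreal \<bar>\<sigma> i x\<bar>)) Q)"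
    using dual_measurable by (subst nn_integral_sum) (auto simp: emeasure_density intro!: sum.cong)
  also have "\<dots> < \<infinity>"
    using dual_integrable Q by (auto simp: cube_integrable_def less_top)
  finally show "emeasure (density lebesgue (\<lambda>x. ennreal \<bar>\<nu> x\<bar>)) Q \<noteq> \<infinity>" by simp
qed

lemma testing_cube:
  assumes R: "R \<in> cubes"
  shows "(\<integral>\<^sup>+x\<in>R. frac_maximal m \<alpha> (\<lambda>i y. \<sigma> i y * indicator R y) x epowr q * ennreal (v x) \<partial>lebesgue)
    \<le> ennreal (K powr q * mass \<nu> R powr (q / p))" (is "?I \<le> _")
proof -
  have [measurable]: "\<nu> \<in> borel_measurable lebesgue" using nu_integrable by (simp add: cube_integrable_def)
  define N where "N = mass \<nu> R"
  \<comment> \<open>With \<open>\<nu>(R)\<close> positive and finite, the quotient in the testing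
    constant can be cleared without meeting division by 0 or infinity.\<close>
  have "0 < N" unfolding N_def by (rule mass_pos[OF nu_integrable nu_pos R])
  have "weight_of \<nu> R = emeasure (density lebesgue (\<lambda>x. ennreal \<bar>\<nu> x\<bar>)) R"
    using cubes_sets[OF R] by (simp add: weight_of_def emeasure_density)
  also have "\<dots> = ennreal N"
    using nu_integrable R unfolding N_def mass_def
    by (intro emeasure_eq_ennreal_measure) (auto simp: cube_integrable_def)
  finally have N: "weight_of \<nu> R = ennreal N" .
  have "?I epowr (1 / q) / weight_of \<nu> R epowr (1 / p) \<le> sawyer_const m \<alpha> p P q w v"
    unfolding sawyer_const_def by (rule SUP_upper[OF R])
  also have "\<dots> = ennreal K" using testing by (simp add: K_def)
  finally have "?I epowr (1 / q) / ennreal (N powr (1 / p)) \<le> ennreal K"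
    using \<open>0 < N\<close> by (simp add: N)
  then have "?I epowr (1 / q) \<le> ennreal K * ennreal (N powr (1 / p))"
    using \<open>0 < N\<close> K_nonneg by (intro ennreal_le_mult_of_divide_le) auto
  also have "\<dots> = ennreal (K * N powr (1 / p))" using K_nonneg by (simp add: ennreal_mult)
  finally have "?I \<le> ennreal (K * N powr (1 / p)) epowr (1 / (1 / q))"
    using q_pos by (subst (asm) epowr_le_iff) auto
  also have "\<dots> = ennreal (K powr q * N powr (q / p))"
    using K_nonneg by (simp add: powr_mult powr_powr)
  finally show ?thesis by (simp add: N_def)
qed

lemma finite_V:
  assumes "Q \<in> grid J"
  shows "emeasure V Q \<noteq> \<infinity>"
proof -
  have "emeasure V Q \<le> emeasure (density lebesgue (\<lambda>x. ennreal \<bar>v x\<bar>)) Q"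
    using grid_closure(2)[OF assms] unfolding V_def
    by (auto simp: emeasure_density indicator_def intro!: nn_integral_mono ennreal_leI)
  also have "\<dots> = emeasure (density lebesgue (\<lambda>x. ennreal \<bar>v x\<bar>)) (closure Q)"
    by (subst emeasure_density_closure_grid[OF assms]) auto
  also have "\<dots> < \<infinity>"
    using weight_cube_integrable[OF v] grid_closure(1)[OF assms]
    by (auto simp: cube_integrable_def less_top)
  finally show ?thesis by simp
qed

lemma finite_density_grid:
  assumes "Q \<in> grid J" "cube_integrable g"
  shows "emeasure (density lebesgue (\<lambda>x. ennreal \<bar>g x\<bar>)) Q \<noteq> \<infinity>"
proof -
  have [measurable]: "g \<in> borel_measurable lebesgue" using assms(2) by (simp add: cube_integrable_def)
  have "emeasure (density lebesgue (\<lambda>x. ennreal \<bar>g x\<bar>)) (closure Q) \<noteq> \<infinity>"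
    using assms(2) grid_closure(1)[OF assms(1)] unfolding cube_integrable_def by (elim conjE bspec)
  then show ?thesis
    by (subst (asm) emeasure_density_closure_grid[OF assms(1)]) auto
qed

lemma frac_avg_localized:
  assumes "R \<in> cubes" "Q \<in> cubes" "Q \<subseteq> R"
  shows "frac_avg m \<alpha> (\<lambda>i y. \<sigma> i y * indicator R y) Q = frac_avg m \<alpha> \<sigma> Q"
proof -
  have "mass (\<lambda>y. \<sigma> i y * indicator R y) Q = mass (\<sigma> i) Q" if i: "i \<in> {1..m}" for i
  proof -
    have [measurable]: "\<sigma> i \<in> borel_measurable lebesgue" "Q \<in> sets lebesgue" "R \<in> sets lebesgue"
      using dual_measurable[OF i] assms cubes_sets by auto
    show ?thesis
      using assms(3) by (auto simp: mass_def measure_def emeasure_density indicator_def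
        intro!: arg_cong[of _ _ enn2real] nn_integral_cong)
  qed
  then show ?thesis by (simp add: frac_avg_def)
qed

lemma localized_integrable:
  assumes "R \<in> cubes" "i \<in> {1..m}"
  shows "cube_integrable (\<lambda>y. \<sigma> i y * indicator R y)"
  unfolding cube_integrable_def
proof (intro conjI ballI)
  have [measurable]: "\<sigma> i \<in> borel_measurable lebesgue" "R \<in> sets lebesgue"
    using dual_measurable[OF assms(2)] cubes_sets[OF assms(1)] by auto
  show "(\<lambda>y. \<sigma> i y * indicator R y) \<in> borel_measurable lebesgue" by measurable
  fix Q :: "(real ^ 'n) set" assume Q: "Q \<in> cubes"
  note [measurable] = cubes_sets[OF Q]
  have "emeasure (density lebesgue (\<lambda>x. ennreal \<bar>\<sigma> i x * indicator R x\<bar>)) Q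
      \<le> emeasure (density lebesgue (\<lambda>x. ennreal \<bar>\<sigma> i x\<bar>)) Q"
    by (auto simp: emeasure_density indicator_def intro!: nn_integral_mono)
  also have "\<dots> < \<infinity>" using dual_integrable[OF assms(2)] Q by (auto simp: cube_integrable_def less_top)
  finally show "emeasure (density lebesgue (\<lambda>x. ennreal \<bar>\<sigma> i x * indicator R x\<bar>)) Q \<noteq> \<infinity>" by simp
qed

section \<open>Finitely many cells of one grid\<close>

lemma sum_measure_V:
  assumes "finite F" "F \<subseteq> grid J" "\<And>Q. Q \<in> F \<Longrightarrow> 0 \<le> a Q"
    and E: "\<And>Q. Q \<in> F \<Longrightarrow> E Q \<in> sets lebesgue" "\<And>Q. Q \<in> F \<Longrightarrow> E Q \<subseteq> Q"
  shows "ennreal (\<Sum>Q\<in>F. a Q * measure V (E Q))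
    = (\<integral>\<^sup>+x. (\<Sum>Q\<in>F. ennreal (a Q) * indicator (E Q) x) * ennreal (v x) \<partial>lebesgue)"
proof -
  have fE: "emeasure V (E Q) \<noteq> \<infinity>" if "Q \<in> F" for Q
    using emeasure_mono[OF E(2)[OF that], of V] finite_V[of Q J] grid_closure(2)[of Q J] assms(2) that
    by (auto simp: top_unique)
  have "ennreal (\<Sum>Q\<in>F. a Q * measure V (E Q)) = (\<Sum>Q\<in>F. ennreal (a Q) * emeasure V (E Q))"
    using fE assms(3) by (subst sum_ennreal[symmetric])
      (auto simp: ennreal_mult emeasure_eq_ennreal_measure intro!: sum.cong)
  also have "\<dots> = (\<Sum>Q\<in>F. \<integral>\<^sup>+x. ennreal (a Q) * indicator (E Q) x * ennreal (v x) \<partial>lebesgue)"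
  proof (rule sum.cong[OF refl])
    fix Q assume "Q \<in> F"
    then have [measurable]: "E Q \<in> sets lebesgue" using E by auto
    have "ennreal (a Q) * emeasure V (E Q) = (\<integral>\<^sup>+x. ennreal (a Q) * (ennreal (v x) * indicator (E Q) x) \<partial>lebesgue)"
      unfolding V_def by (subst nn_integral_cmult) (auto simp: emeasure_density)
    then show "ennreal (a Q) * emeasure V (E Q)
        = (\<integral>\<^sup>+x. ennreal (a Q) * indicator (E Q) x * ennreal (v x) \<partial>lebesgue)"
      by (simp add: mult_ac)
  qed
  also have "\<dots> = (\<integral>\<^sup>+x. (\<Sum>Q\<in>F. ennreal (a Q) * indicator (E Q) x * ennreal (v x)) \<partial>lebesgue)"
    using E(1) by (subst nn_integral_sum) auto
  finally show ?thesis by (simp add: sum_distrib_right)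
qed

text \<open>For \<open>x\<close> in \<open>E Q\<close> with \<open>Q \<subseteq> R\<close>, cutting
  the \<open>\<sigma> i\<close> off outside the closure of \<open>R\<close> does not affect the
  average over \<open>Q\<close>, which is therefore at most the maximal function of the cut-off
  functions at \<open>x\<close>. As the sets \<open>E Q\<close> are disjoint, the sum is at most the
  integral in the testing condition for the closure of \<open>R\<close>.\<close>

lemma testing_carleson:
  assumes F: "finite F" "F \<subseteq> grid J" and R: "R \<in> F"
    and E: "\<And>Q. Q \<in> F \<Longrightarrow> E Q \<in> sets lebesgue" "\<And>Q. Q \<in> F \<Longrightarrow> E Q \<subseteq> Q" "disjoint_family_on E F"
  shows "(\<Sum>Q | Q \<in> F \<and> Q \<subseteq> R. frac_avg m \<alpha> \<sigma> Q powr q * measure V (E Q)) \<le> K powr q * mass \<nu> R powr (q / p)"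
proof -
  let ?F = "{Q\<in>F. Q \<subseteq> R}"
  have RJ: "R \<in> grid J" using R F by auto
  note Rc = grid_closure(1)[OF RJ]
  have "ennreal (\<Sum>Q\<in>?F. frac_avg m \<alpha> \<sigma> Q powr q * measure V (E Q))
      = (\<integral>\<^sup>+x. (\<Sum>Q\<in>?F. ennreal (frac_avg m \<alpha> \<sigma> Q powr q) * indicator (E Q) x) * ennreal (v x) \<partial>lebesgue)"
    using F E by (intro sum_measure_V) auto
  also have "\<dots> \<le> (\<integral>\<^sup>+x\<in>closure R. frac_maximal m \<alpha> (\<lambda>i y. \<sigma> i y * indicator (closure R) y) x epowr q * ennreal (v x) \<partial>lebesgue)"
    (is "_ \<le> (\<integral>\<^sup>+x\<in>_. ?M x epowr q * _ \<partial>_)")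
  proof (rule nn_integral_mono)
    fix x
    have "(\<Sum>Q\<in>?F. ennreal (frac_avg m \<alpha> \<sigma> Q powr q) * indicator (E Q) x) \<le> ?M x epowr q * indicator (closure R) x"
    proof (rule disjoint_family_sum_indicator_le)
      fix Q assume Q: "Q \<in> ?F" "x \<in> E Q"
      then have QJ: "Q \<in> grid J" and x: "x \<in> Q" and QR: "closure Q \<subseteq> closure R"
        using F E by (auto intro: closure_mono[THEN subsetD])
      have xc: "x \<in> closure Q" using x closure_subset by blast
      have "frac_avg m \<alpha> \<sigma> Q = frac_avg m \<alpha> \<sigma> (closure Q)"
        using dual_integrable by (intro frac_avg_closure_grid[OF QJ, symmetric])
      also have "\<dots> = frac_avg m \<alpha> (\<lambda>i y. \<sigma> i y * indicator (closure R) y) (closure Q)"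
        by (rule frac_avg_localized[OF Rc grid_closure(1)[OF QJ] QR, symmetric])
      finally have "ennreal (frac_avg m \<alpha> \<sigma> Q) \<le> ?M x"
        using frac_maximal_ge[OF m _ grid_closure(1)[OF QJ] xc, of "\<lambda>i y. \<sigma> i y * indicator (closure R) y" \<alpha>]
          localized_integrable[OF Rc] by simp
      then have "ennreal (frac_avg m \<alpha> \<sigma> Q) epowr q \<le> ?M x epowr q"
        using q_pos by (intro epowr_mono) auto
      then show "ennreal (frac_avg m \<alpha> \<sigma> Q powr q) \<le> ?M x epowr q * indicator (closure R) x"
        using xc QR by (auto simp: indicator_def)
    qed (use F E in \<open>auto intro: disjoint_family_on_mono[of _ F]\<close>)
    from mult_right_mono[OF this zero_le, of "ennreal (v x)"]
    show "(\<Sum>Q\<in>?F. ennreal (frac_avg m \<alpha> \<sigma> Q powr q) * indicator (E Q) x) * ennreal (v x)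
        \<le> ?M x epowr q * ennreal (v x) * indicator (closure R) x"
      by (simp only: mult_ac)
  qed
  also have "\<dots> \<le> ennreal (K powr q * mass \<nu> R powr (q / p))"
    using testing_cube[OF Rc] mass_closure_grid[OF RJ nu_integrable] by simp
  finally show ?thesis
    by (subst (asm) ennreal_le_iff) auto
qed

text \<open>Two selections are in play. The given sets \<open>E\<close> linearise the maximal
  function of \<open>f\<close> and are measured by \<open>v\<close>; the sets \<open>G\<close>
  chosen in the proof realise the maximum of \<open>u\<close> and are measured by
  \<open>\<nu>\<close> and by the \<open>\<sigma> i\<close>.\<close>

lemma finite_grid_estimate:
  assumes F: "finite F" "F \<subseteq> grid J"
    and E: "\<And>Q. Q \<in> F \<Longrightarrow> E Q \<in> sets lebesgue" "\<And>Q. Q \<in> F \<Longrightarrow> E Q \<subseteq> Q" "disjoint_family_on E F"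
    and f: "\<And>i. i \<in> {1..m} \<Longrightarrow> cube_integrable (f i)"
    and norm: "\<And>i. i \<in> {1..m} \<Longrightarrow> (\<integral>\<^sup>+x. ennreal (\<bar>f i x\<bar> powr P i) * ennreal (w i x) \<partial>lebesgue) \<le> 1"
  shows "(\<Sum>Q\<in>F. frac_avg m \<alpha> f Q powr q * measure V (E Q)) \<le> embedding_factor m p q P * K powr q"
proof -
  define c where "c i Q = mass (f i) Q / mass (\<sigma> i) Q" for i Q
  \<comment> \<open>With this power, \<open>u Q powr (q / p)\<close> is the \<open>q\<close>-th
    power of the product, as the Carleson embedding of order \<open>q / p\<close> requires.\<close>
  define u where "u Q = (\<Prod>i = 1..m. c i Q) powr p" for Q
  have laminar: "laminar F" using laminar_grid[of J] F(2) by (auto simp: laminar_def subset_eq)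
  have sets: "F \<subseteq> sets lebesgue" using F(2) grid_closure(2) by blast
  have S_pos: "0 < mass (\<sigma> i) Q" if "i \<in> {1..m}" "Q \<in> F" for i Q
  proof -
    have "0 < mass (\<sigma> i) (closure Q)"
      using that dual F(2) by (intro mass_pos dual_integrable grid_closure(1)) (auto simp: weight_def)
    then show ?thesis using mass_closure_grid[of Q J "\<sigma> i"] dual_integrable that F(2) by auto
  qed
  have c0: "0 \<le> c i Q" for i Q by (simp add: c_def)
  have u0: "0 \<le> u Q" for Q by (simp add: u_def)
  obtain G where G: "\<And>Q. Q \<in> F \<Longrightarrow> G Q \<in> sets lebesgue" "\<And>Q. Q \<in> F \<Longrightarrow> G Q \<subseteq> Q" "disjoint_family_on G F"
      "\<And>Q x. Q \<in> F \<Longrightarrow> x \<in> Q \<Longrightarrow> \<exists>R\<in>F. x \<in> G R \<and> u Q \<le> u R"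
    by (rule maximal_selection[OF F(1) sets, of u]) (rule that)
  have mass_\<sigma>: "mass (\<sigma> i) = measure (density lebesgue (\<lambda>x. ennreal (\<sigma> i x)))" for i
    by (simp add: mass_def[abs_def])
  have mass_\<nu>: "mass \<nu> = measure (density lebesgue (\<lambda>x. ennreal (\<nu> x)))"
    by (simp add: mass_def[abs_def])
  have fin\<sigma>: "emeasure (density lebesgue (\<lambda>x. ennreal (\<sigma> i x))) Q \<noteq> \<infinity>" if "i \<in> {1..m}" "Q \<in> F" for i Q
    using finite_density_grid[OF _ dual_integrable[OF that(1)], of Q J] that(2) F(2) by auto
  have fin\<sigma>G: "emeasure (density lebesgue (\<lambda>x. ennreal (\<sigma> i x))) (G Q) \<noteq> \<infinity>" if "i \<in> {1..m}" "Q \<in> F" for i Q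
    using emeasure_mono[OF G(2)[OF that(2)], of "density lebesgue (\<lambda>x. ennreal (\<sigma> i x))"]
      fin\<sigma>[OF that] sets that(2) by (auto simp: top_unique)
  have fin\<nu>: "emeasure (density lebesgue (\<lambda>x. ennreal (\<nu> x))) Q \<noteq> \<infinity>" if "Q \<in> F" for Q
    using finite_density_grid[OF _ nu_integrable, of Q J] that F(2) by auto

  have factor: "frac_avg m \<alpha> f Q powr q = frac_avg m \<alpha> \<sigma> Q powr q * u Q powr (q / p)" if "Q \<in> F" for Q
  proof -
    have "(\<Prod>i = 1..m. mass (f i) Q) = (\<Prod>i = 1..m. mass (\<sigma> i) Q) * (\<Prod>i = 1..m. c i Q)"
      unfolding prod.distrib[symmetric] using S_pos[OF _ that]
      by (intro prod.cong refl) (auto simp: c_def less_le)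
    then have "frac_avg m \<alpha> f Q = frac_avg m \<alpha> \<sigma> Q * (\<Prod>i = 1..m. c i Q)"
      by (simp add: frac_avg_def)
    moreover have "(\<Prod>i = 1..m. c i Q) powr q = u Q powr (q / p)"
      using p_pos by (simp add: u_def powr_powr)
    ultimately show ?thesis by (simp add: powr_mult prod_nonneg c0)
  qed
  have doob: "(\<Sum>Q\<in>F. c i Q powr P i * mass (\<sigma> i) (G Q)) \<le> (2 * (P i / (P i - 1))) powr P i" if i: "i \<in> {1..m}" for i
  proof -
    note [measurable] = dual_measurable[OF i] w_measurable[OF i]
    have [measurable]: "f i \<in> borel_measurable lebesgue" using f[OF i] by (simp add: cube_integrable_def)
    have "AE x in lebesgue. 0 < w i x" using w[OF i] by (simp add: weight_def)
    \<comment> \<open>Hence \<open>\<sigma> i x powr (1 - P i)\<close> is \<open>w i x\<close>, and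
      the integral in Doob's inequality is the normalised one.\<close>
    moreover have "(1 - conj_exp (P i)) * (1 - P i) = 1"
      using P[OF i] by (simp add: conj_exp_def field_simps)
    ultimately have "(\<integral>\<^sup>+x. ennreal (\<bar>f i x\<bar> powr P i * \<sigma> i x powr (1 - P i)) \<partial>lebesgue)
        = (\<integral>\<^sup>+x. ennreal (\<bar>f i x\<bar> powr P i) * ennreal (w i x) \<partial>lebesgue)"
      by (intro nn_integral_cong_AE) (auto elim!: AE_mp simp: dual_weight_def powr_powr ennreal_mult)
    then have W: "(\<integral>\<^sup>+x. ennreal (\<bar>f i x\<bar> powr P i * \<sigma> i x powr (1 - P i)) \<partial>lebesgue) \<le> ennreal 1"
      using norm[OF i] by simp
    have "AE x in lebesgue. 0 < \<sigma> i x" using dual[OF i] by (simp add: weight_def)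
    moreover have "emeasure (density lebesgue (\<lambda>x. ennreal \<bar>f i x\<bar>)) Q \<noteq> \<infinity>" if "Q \<in> F" for Q
      using finite_density_grid[OF _ f[OF i], of Q J] that F(2) by auto
    ultimately show ?thesis
      using laminar_doob[OF F(1) laminar sets P[OF i], of "\<lambda>x. \<bar>f i x\<bar>" "\<sigma> i" 1 G] W G fin\<sigma>[OF i]
      by (simp add: c_def mass_\<sigma> mass_def[of "f i"])
  qed
  have "(\<Sum>Q\<in>F. u Q * mass \<nu> (G Q)) \<le> (\<Sum>Q\<in>F. \<Sum>i = 1..m. p / P i * c i Q powr P i * mass (\<sigma> i) (G Q))"
  proof (rule sum_mono)
    fix Q assume Q: "Q \<in> F"
    show "u Q * mass \<nu> (G Q) \<le> (\<Sum>i = 1..m. p / P i * c i Q powr P i * mass (\<sigma> i) (G Q))"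
      unfolding mass_\<sigma> mass_\<nu>
    proof (rule measure_density_le_sum)
      show "AE x in lebesgue. x \<in> G Q \<longrightarrow> u Q * \<nu> x \<le> (\<Sum>i = 1..m. p / P i * c i Q powr P i * \<sigma> i x)"
      proof (intro AE_I2 impI)
        fix x
        have "u Q * \<nu> x = (\<Prod>i = 1..m. c i Q powr p * \<sigma> i x powr (p / P i))"
          by (simp add: u_def nu_weight_def prod.distrib prod_powr_distrib c0)
        \<comment> \<open>Writing \<open>c i Q powr p\<close> as
          \<open>(c i Q powr P i) powr (p / P i)\<close> brings both factors under the exponents
          \<open>p / P i\<close>, whose sum is 1.\<close>
        also have "\<dots> = (\<Prod>i = 1..m. (c i Q powr P i * \<sigma> i x) powr (p / P i))"
          using P by (intro prod.cong refl) (force simp: powr_mult powr_powr)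
        also have "\<dots> \<le> (\<Sum>i = 1..m. p / P i * (c i Q powr P i * \<sigma> i x))"
          using exponents by (intro prod_powr_le_weighted_sum) auto
        finally show "u Q * \<nu> x \<le> (\<Sum>i = 1..m. p / P i * c i Q powr P i * \<sigma> i x)"
          by (simp add: mult.assoc)
      qed
      show "0 \<le> p / P i * c i Q powr P i" if "i \<in> {1..m}" for i
        using exponents(2)[OF that] by (intro mult_nonneg_nonneg) auto
    qed (use nu_integrable u0 dual_measurable G(1)[OF Q] fin\<sigma>G[OF _ Q] in \<open>auto simp: cube_integrable_def\<close>)
  qed
  also have "\<dots> = (\<Sum>i = 1..m. p / P i * (\<Sum>Q\<in>F. c i Q powr P i * mass (\<sigma> i) (G Q)))"
    by (subst sum.swap) (simp add: sum_distrib_left mult.assoc)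
  also have "\<dots> \<le> (\<Sum>i = 1..m. p / P i * (2 * (P i / (P i - 1))) powr P i)"
    using exponents(2) by (intro sum_mono mult_left_mono doob) (auto simp: less_imp_le)
  finally have B: "(\<Sum>Q\<in>F. u Q * mass \<nu> (G Q)) \<le> (\<Sum>i = 1..m. p / P i * (2 * (P i / (P i - 1))) powr P i)" .

  have "(\<Sum>Q\<in>F. frac_avg m \<alpha> f Q powr q * measure V (E Q))
      = (\<Sum>Q\<in>F. (frac_avg m \<alpha> \<sigma> Q powr q * measure V (E Q)) * u Q powr (q / p))"
    by (intro sum.cong refl) (simp add: factor mult_ac)
  also have "\<dots> \<le> q / p * K powr q * (\<Sum>Q\<in>F. u Q * mass \<nu> (G Q)) powr (q / p)"
    unfolding mass_\<nu>
  proof (rule carleson_embedding[OF F(1) laminar])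
    show "(\<Sum>Q | Q \<in> F \<and> Q \<subseteq> R. frac_avg m \<alpha> \<sigma> Q powr q * measure V (E Q))
        \<le> K powr q * measure (density lebesgue (\<lambda>x. ennreal (\<nu> x))) R powr (q / p)" if "R \<in> F" for R
      using testing_carleson[OF F that E] by (simp add: mass_\<nu>)
    show "1 \<le> q / p" using p_pos pq by simp
  qed (use sets fin\<nu> G u0 in auto)
  also have "\<dots> \<le> q / p * K powr q * (\<Sum>i = 1..m. p / P i * (2 * (P i / (P i - 1))) powr P i) powr (q / p)"
    using B p_pos q_pos u0 by (intro mult_left_mono powr_mono2) (auto intro!: sum_nonneg)
  also have "\<dots> = embedding_factor m p q P * K powr q" by (simp add: embedding_factor_def)
  finally show ?thesis .
qed

end

section \<open>From one grid to all cubes\<close>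

definition maximal_factor :: "nat \<Rightarrow> nat \<Rightarrow> real \<Rightarrow> real \<Rightarrow> real \<Rightarrow> (nat \<Rightarrow> real) \<Rightarrow> real" where
  "maximal_factor n m \<alpha> p q P = (6 powr (real n * real m - \<alpha>)) powr q * (2 ^ n * embedding_factor m p q P)"

text \<open>Passing to a larger cell only increases the masses, and its volume is at most
  \<open>6 ^ CARD('n)\<close> times that of \<open>Q\<close>. By
  \<open>\<alpha> < real m * real CARD('n)\<close> the volume enters with a negative exponent, so
  the loss is the stated power of 6.\<close>

lemma frac_avg_le_grid:
  fixes f :: "nat \<Rightarrow> real ^ 'n \<Rightarrow> real"
  assumes \<alpha>: "\<alpha> < real m * real CARD('n)" and f: "\<And>i. i \<in> {1..m} \<Longrightarrow> cube_integrable (f i)" and Q: "Q \<in> cubes"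
  shows "\<exists>J. \<exists>R\<in>grid J. Q \<subseteq> R \<and>
    frac_avg m \<alpha> f Q \<le> 6 powr (real CARD('n) * real m - \<alpha>) * frac_avg m \<alpha> f R"
proof -
  obtain a l where l: "0 < l" "Q = cbox a (a + l *\<^sub>R One)" "measure lebesgue Q = l ^ CARD('n)"
    using Q by (rule cubesE)
  obtain J R where R: "R \<in> grid J" "Q \<subseteq> R" "measure lebesgue (closure R) \<le> (6 * l) ^ CARD('n)"
    using cube_subset_grid[OF l(1), of a] unfolding l(2) by blast
  note Rc = grid_closure(1)[OF R(1)]
  define L where "L = measure lebesgue (closure R)"
  define b where "b = \<alpha> / real CARD('n) - real m"
  have "0 < L" unfolding L_def using Rc by (rule cubesE)
  have b: "b < 0" using \<alpha> by (simp add: b_def field_simps)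
  have "(l ^ CARD('n)) powr b \<le> (L / 6 ^ CARD('n)) powr b"
    using R(3) b \<open>0 < L\<close> by (intro powr_mono2') (auto simp: L_def[symmetric] field_simps)
  also have "\<dots> = L powr b * (6 ^ CARD('n)) powr (- b)"
    using \<open>0 < L\<close> by (subst powr_divide) (auto simp: powr_minus divide_inverse)
  also have "(6 ^ CARD('n)) powr (- b) = 6 powr (real CARD('n) * real m - \<alpha>)"
    by (subst powr_realpow[symmetric]) (auto simp: powr_powr b_def right_diff_distrib)
  finally have 1: "measure lebesgue Q powr b \<le> 6 powr (real CARD('n) * real m - \<alpha>) * L powr b"
    unfolding l(3) by (simp add: mult.commute)
  have 2: "(\<Prod>i = 1..m. mass (f i) Q) \<le> (\<Prod>i = 1..m. mass (f i) (closure R))"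
    using R(2) closure_subset[of R] Q
    by (intro prod_mono conjI mass_nonneg mass_mono f Rc cubes_sets) auto
  have "frac_avg m \<alpha> f Q \<le> (6 powr (real CARD('n) * real m - \<alpha>) * L powr b) * (\<Prod>i = 1..m. mass (f i) (closure R))"
    unfolding frac_avg_def b_def[symmetric]
    using 1 2 by (intro mult_mono) (auto intro!: prod_nonneg)
  also have "\<dots> = 6 powr (real CARD('n) * real m - \<alpha>) * frac_avg m \<alpha> f (closure R)"
    by (simp only: frac_avg_def b_def L_def mult.assoc)
  finally show ?thesis
    using frac_avg_closure_grid[OF R(1), of m f \<alpha>] f R(1,2) by auto
qed

context sawyer_testing
begin

text \<open>The countable grid is exhausted by the increasing finite families \<open>F j\<close>. On
  each one the supremum is attained and is linearised by a maximal selection for the averages of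
  \<open>f\<close>; monotone convergence gives the whole grid.\<close>

lemma grid_estimate:
  assumes f: "\<And>i. i \<in> {1..m} \<Longrightarrow> cube_integrable (f i)"
    and norm: "\<And>i. i \<in> {1..m} \<Longrightarrow> (\<integral>\<^sup>+x. ennreal (\<bar>f i x\<bar> powr P i) * ennreal (w i x) \<partial>lebesgue) \<le> 1"
  shows "(\<integral>\<^sup>+x. (SUP Q\<in>grid J. ennreal (frac_avg m \<alpha> f Q powr q) * indicator Q x) * ennreal (v x) \<partial>lebesgue)
    \<le> ennreal (embedding_factor m p q P * K powr q)"
proof -
  have ne: "grid J \<noteq> {}" by (auto simp: grid_def)
  define F where "F j = from_nat_into (grid J) ` {..j}" for j
  have F: "finite (F j)" "F j \<subseteq> grid J" "F j \<noteq> {}" for j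
    using from_nat_into[OF ne] by (auto simp: F_def)
  have UF: "(\<Union>j. F j) = grid J"
  proof -
    have "(\<Union>j. F j) = range (from_nat_into (grid J))" unfolding F_def by (auto simp: image_iff)
    then show ?thesis using range_from_nat_into[OF ne countable_grid] by simp
  qed
  define h where "h j x = (SUP Q\<in>F j. ennreal (frac_avg m \<alpha> f Q powr q) * indicator Q x)" for j x
  have h_SUP: "(SUP Q\<in>grid J. ennreal (frac_avg m \<alpha> f Q powr q) * indicator Q x) = (SUP j. h j x)" for x
    unfolding h_def UF[symmetric] by (rule SUP_UNION)
  have sets: "Q \<in> sets lebesgue" if "Q \<in> F j" for Q j
    using that F(2) grid_closure(2) by blast
  have [measurable]: "h j \<in> borel_measurable lebesgue" for j
    unfolding h_def[abs_def] using F sets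
    by (intro borel_measurable_SUP countable_finite) auto
  have inc: "incseq (\<lambda>j x. h j x * ennreal (v x))"
    by (auto simp: incseq_def le_fun_def h_def F_def intro!: mult_right_mono SUP_subset_mono)
  have "(\<integral>\<^sup>+x. (SUP Q\<in>grid J. ennreal (frac_avg m \<alpha> f Q powr q) * indicator Q x) * ennreal (v x) \<partial>lebesgue)
      = (\<integral>\<^sup>+x. (SUP j. h j x * ennreal (v x)) \<partial>lebesgue)"
    by (simp add: h_SUP SUP_mult_right_ennreal)
  also have "\<dots> = (SUP j. \<integral>\<^sup>+x. h j x * ennreal (v x) \<partial>lebesgue)"
    using inc by (intro nn_integral_monotone_convergence_SUP) auto
  also have "\<dots> \<le> ennreal (embedding_factor m p q P * K powr q)"
  proof (rule SUP_least)
    fix j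
    have setsF: "F j \<subseteq> sets lebesgue" using sets by blast
    obtain E where E: "\<And>Q. Q \<in> F j \<Longrightarrow> E Q \<in> sets lebesgue" "\<And>Q. Q \<in> F j \<Longrightarrow> E Q \<subseteq> Q" "disjoint_family_on E (F j)"
      "\<And>Q x. Q \<in> F j \<Longrightarrow> x \<in> Q \<Longrightarrow> \<exists>R\<in>F j. x \<in> E R \<and> frac_avg m \<alpha> f Q \<le> frac_avg m \<alpha> f R"
      by (rule maximal_selection[OF F(1) setsF, of "frac_avg m \<alpha> f"]) (rule that)
    have "h j x \<le> (\<Sum>Q\<in>F j. ennreal (frac_avg m \<alpha> f Q powr q) * indicator (E Q) x)" for x
      unfolding h_def
    proof (rule SUP_least)
      fix Q assume Q: "Q \<in> F j"
      show "ennreal (frac_avg m \<alpha> f Q powr q) * indicator Q x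
          \<le> (\<Sum>Q\<in>F j. ennreal (frac_avg m \<alpha> f Q powr q) * indicator (E Q) x)"
      proof (cases "x \<in> Q")
        case True
        then obtain R where R: "R \<in> F j" "x \<in> E R" "frac_avg m \<alpha> f Q \<le> frac_avg m \<alpha> f R"
          using E(4)[OF Q] by auto
        have "ennreal (frac_avg m \<alpha> f Q powr q) * indicator Q x \<le> ennreal (frac_avg m \<alpha> f R powr q) * indicator (E R) x"
          using R True q_pos by (auto intro!: ennreal_leI powr_mono2)
        also have "\<dots> \<le> (\<Sum>Q\<in>F j. ennreal (frac_avg m \<alpha> f Q powr q) * indicator (E Q) x)"
          using F(1) R(1) by (intro member_le_sum) auto
        finally show ?thesis .
      qed simp
    qed
    then have "(\<integral>\<^sup>+x. h j x * ennreal (v x) \<partial>lebesgue)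
        \<le> (\<integral>\<^sup>+x. (\<Sum>Q\<in>F j. ennreal (frac_avg m \<alpha> f Q powr q) * indicator (E Q) x) * ennreal (v x) \<partial>lebesgue)"
      by (intro nn_integral_mono mult_right_mono) auto
    also have "\<dots> = ennreal (\<Sum>Q\<in>F j. frac_avg m \<alpha> f Q powr q * measure V (E Q))"
      using F E by (intro sum_measure_V[symmetric]) auto
    also have "\<dots> \<le> ennreal (embedding_factor m p q P * K powr q)"
      using finite_grid_estimate[OF F(1,2) E(1-3) f norm] by (intro ennreal_leI)
    finally show "(\<integral>\<^sup>+x. h j x * ennreal (v x) \<partial>lebesgue) \<le> ennreal (embedding_factor m p q P * K powr q)" .
  qed
  finally show ?thesis .
qed

lemma embedding_factor_nonneg: "0 \<le> embedding_factor m p q P"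
  using p_pos q_pos by (simp add: embedding_factor_def)

lemma normalized_estimate:
  assumes f: "\<And>i. i \<in> {1..m} \<Longrightarrow> cube_integrable (f i)"
    and norm: "\<And>i. i \<in> {1..m} \<Longrightarrow> (\<integral>\<^sup>+x. ennreal (\<bar>f i x\<bar> powr P i) * ennreal (w i x) \<partial>lebesgue) \<le> 1"
  shows "(\<integral>\<^sup>+x. frac_maximal m \<alpha> f x epowr q * ennreal (v x) \<partial>lebesgue)
    \<le> ennreal (maximal_factor CARD('n) m \<alpha> p q P * K powr q)"
proof -
  define c where "c = 6 powr (real CARD('n) * real m - \<alpha>)"
  define S where "S J x = (SUP Q\<in>grid J. ennreal (frac_avg m \<alpha> f Q powr q) * indicator Q x)" for J x
  have [measurable]: "S J \<in> borel_measurable lebesgue" for J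
    unfolding S_def[abs_def]
    by (intro borel_measurable_SUP[OF countable_grid])
       (intro borel_measurable_times_ennreal borel_measurable_const borel_measurable_indicator grid_closure(2))
  \<comment> \<open>Each cube is dominated by a cell of one of the grids; as the grid varies with
    the cube, the contributions of all grids are added.\<close>
  have "frac_maximal m \<alpha> f x epowr q \<le> ennreal (c powr q) * (\<Sum>J\<in>UNIV. S J x)" for x
    unfolding epowr_le_iff[OF q_pos]
  proof (rule frac_maximal_le[OF m])
    show "cube_integrable (f i)" if "i \<in> {1..m}" for i using f[OF that] .
  next
    fix Q assume Q: "Q \<in> cubes" "x \<in> Q"
    have "\<exists>J. \<exists>R\<in>grid J. Q \<subseteq> R \<and> frac_avg m \<alpha> f Q \<le> c * frac_avg m \<alpha> f R"
      unfolding c_def using \<alpha> f Q(1) by (intro frac_avg_le_grid)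
    then obtain J R where R: "R \<in> grid J" "Q \<subseteq> R" "frac_avg m \<alpha> f Q \<le> c * frac_avg m \<alpha> f R"
      by auto
    have "ennreal (frac_avg m \<alpha> f Q) epowr q \<le> ennreal ((c * frac_avg m \<alpha> f R) powr q)"
      using R(3) q_pos by (auto intro!: ennreal_leI powr_mono2)
    also have "\<dots> = ennreal (c powr q) * (ennreal (frac_avg m \<alpha> f R powr q) * indicator R x)"
      using subsetD[OF R(2) Q(2)] by (simp add: c_def powr_mult ennreal_mult)
    also have "\<dots> \<le> ennreal (c powr q) * S J x"
      unfolding S_def
      by (intro mult_left_mono SUP_upper[OF R(1), of "\<lambda>Q. ennreal (frac_avg m \<alpha> f Q powr q) * indicator Q x"]) simp
    also have "\<dots> \<le> ennreal (c powr q) * (\<Sum>J\<in>UNIV. S J x)"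
      by (intro mult_left_mono member_le_sum) auto
    finally show "ennreal (frac_avg m \<alpha> f Q) \<le> (ennreal (c powr q) * (\<Sum>J\<in>UNIV. S J x)) epowr (1 / q)"
      unfolding epowr_le_iff[OF q_pos] .
  qed
  then have "(\<integral>\<^sup>+x. frac_maximal m \<alpha> f x epowr q * ennreal (v x) \<partial>lebesgue)
      \<le> (\<integral>\<^sup>+x. (ennreal (c powr q) * (\<Sum>J\<in>UNIV. S J x)) * ennreal (v x) \<partial>lebesgue)"
    by (intro nn_integral_mono mult_right_mono) auto
  also have "\<dots> = (\<integral>\<^sup>+x. ennreal (c powr q) * (\<Sum>J\<in>UNIV. S J x * ennreal (v x)) \<partial>lebesgue)"
    by (simp add: sum_distrib_right mult.assoc)
  also have "\<dots> = ennreal (c powr q) * (\<Sum>J\<in>UNIV. \<integral>\<^sup>+x. S J x * ennreal (v x) \<partial>lebesgue)"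
    by (simp add: nn_integral_cmult nn_integral_sum)
  also have "\<dots> \<le> ennreal (c powr q) * (\<Sum>J\<in>(UNIV :: 'n set set). ennreal (embedding_factor m p q P * K powr q))"
    unfolding S_def by (intro mult_left_mono sum_mono grid_estimate[of f] f norm) auto
  \<comment> \<open>One grid for each set \<open>J\<close> of shifted directions.\<close>
  also have "\<dots> = ennreal (c powr q) * (ennreal (2 ^ CARD('n)) * ennreal (embedding_factor m p q P * K powr q))"
    using card_Pow[of "UNIV :: 'n set"]
    by (simp only: sum_constant Pow_UNIV finite ennreal_of_nat_eq_real_of_nat of_nat_power of_nat_numeral)
  also have "\<dots> = ennreal (c powr q * (2 ^ CARD('n) * (embedding_factor m p q P * K powr q)))"
    using embedding_factor_nonneg by (subst (1 2) ennreal_mult) auto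
  also have "\<dots> = ennreal (maximal_factor CARD('n) m \<alpha> p q P * K powr q)"
    by (simp add: maximal_factor_def c_def mult_ac)
  finally show ?thesis .
qed

lemma maximal_factor_nonneg: "0 \<le> maximal_factor CARD('n) m \<alpha> p q P"
  using embedding_factor_nonneg by (simp add: maximal_factor_def)

end

section \<open>Scaling and the norm inequality\<close>

lemma mass_scale:
  assumes [measurable]: "f \<in> borel_measurable lebesgue" "Q \<in> sets lebesgue" and "0 \<le> c"
  shows "mass (\<lambda>x. c * f x) Q = c * mass f Q"
proof -
  have "emeasure (density lebesgue (\<lambda>x. ennreal \<bar>c * f x\<bar>)) Q
      = (\<integral>\<^sup>+x. ennreal c * (ennreal \<bar>f x\<bar> * indicator Q x) \<partial>lebesgue)"
    using \<open>0 \<le> c\<close> by (simp add: emeasure_density abs_mult ennreal_mult mult.assoc)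
  also have "\<dots> = ennreal c * emeasure (density lebesgue (\<lambda>x. ennreal \<bar>f x\<bar>)) Q"
    by (simp add: nn_integral_cmult emeasure_density)
  finally show ?thesis
    using \<open>0 \<le> c\<close> by (simp add: mass_def measure_def enn2real_mult)
qed

context sawyer_testing
begin

lemma Lp_norm_eq:
  assumes "f \<in> Lp_space r u" "0 < r"
  shows "Lp_norm r u (\<lambda>x. ennreal \<bar>f x\<bar>)
    = ennreal (enn2real (\<integral>\<^sup>+x. ennreal (\<bar>f x\<bar> powr r) * ennreal (u x) \<partial>lebesgue) powr (1 / r))"
  using assms by (auto simp: Lp_norm_def Lp_space_def epowr_def)

lemma Lp_cube_integrable:
  assumes "i \<in> {1..m}" "f \<in> Lp_space (P i) (w i)"
  shows "cube_integrable f"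
proof (rule cube_integrable_Lp)
  show "cube_integrable (\<lambda>x. w i x powr (1 - conj_exp (P i)))"
    using dual_integrable[OF assms(1)] by (simp add: dual_weight_def[abs_def])
qed (use assms P w w_measurable in \<open>auto simp: Lp_space_def weight_def\<close>)

text \<open>By homogeneity each \<open>f i\<close> may be divided by its norm \<open>N i\<close>,
  which reduces the bound to \<open>normalized_estimate\<close>.\<close>

lemma maximal_estimate:
  assumes f: "\<And>i. i \<in> {1..m} \<Longrightarrow> f i \<in> Lp_space (P i) (w i)"
  shows "Lp_norm q v (frac_maximal m \<alpha> f)
    \<le> ennreal (maximal_factor CARD('n) m \<alpha> p q P powr (1 / q) * K)
      * (\<Prod>i = 1..m. Lp_norm (P i) (w i) (\<lambda>x. ennreal \<bar>f i x\<bar>))"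
proof -
  define r where "r i = enn2real (\<integral>\<^sup>+x. ennreal (\<bar>f i x\<bar> powr P i) * ennreal (w i x) \<partial>lebesgue)" for i
  define N where "N i = r i powr (1 / P i)" for i
  have Ppos: "0 < P i" if "i \<in> {1..m}" for i using P[OF that] by simp
  have fi: "cube_integrable (f i)" if "i \<in> {1..m}" for i using Lp_cube_integrable[OF that f[OF that]] .
  have fm: "f i \<in> borel_measurable lebesgue" if "i \<in> {1..m}" for i using fi[OF that] by (simp add: cube_integrable_def)
  have r: "(\<integral>\<^sup>+x. ennreal (\<bar>f i x\<bar> powr P i) * ennreal (w i x) \<partial>lebesgue) = ennreal (r i)" if "i \<in> {1..m}" for i
    using f[OF that] by (simp add: r_def Lp_space_def less_top)
  have r0: "0 \<le> r i" for i by (simp add: r_def)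
  have prodN: "(\<Prod>i = 1..m. Lp_norm (P i) (w i) (\<lambda>x. ennreal \<bar>f i x\<bar>)) = ennreal (\<Prod>i = 1..m. N i)"
    using f Ppos by (subst prod_ennreal[symmetric]) (auto simp: N_def Lp_norm_eq r_def intro!: prod.cong)
  show ?thesis
  \<comment> \<open>A function of norm 0 cannot be normalised. It vanishes almost everywhere because
    \<open>w i\<close> is positive almost everywhere, so all averages and the maximal function are
    0.\<close>
  proof (cases "\<exists>i\<in>{1..m}. r i = 0")
    case True
    then obtain i where i: "i \<in> {1..m}" "r i = 0" by auto
    note [measurable] = fm[OF i(1)] w_measurable[OF i(1)]
    have "(\<integral>\<^sup>+x. ennreal (\<bar>f i x\<bar> powr P i) * ennreal (w i x) \<partial>lebesgue) = 0"
      using r[OF i(1)] i(2) by simp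
    then have "AE x in lebesgue. ennreal (\<bar>f i x\<bar> powr P i) * ennreal (w i x) = 0"
      by (subst (asm) nn_integral_0_iff_AE) auto
    moreover have "AE x in lebesgue. 0 < w i x" using w[OF i(1)] by (simp add: weight_def)
    ultimately have f0: "AE x in lebesgue. f i x = 0"
      by eventually_elim (auto simp: ennreal_eq_0_iff)
    have mass0: "mass (f i) Q = 0" if "Q \<in> cubes" for Q
    proof -
      note [measurable] = cubes_sets[OF that]
      have "AE x in lebesgue. ennreal \<bar>f i x\<bar> * indicator Q x = 0"
        using f0 by eventually_elim simp
      then have "(\<integral>\<^sup>+x. ennreal \<bar>f i x\<bar> * indicator Q x \<partial>lebesgue) = 0"
        by (subst nn_integral_0_iff_AE) auto
      then have "emeasure (density lebesgue (\<lambda>x. ennreal \<bar>f i x\<bar>)) Q = 0"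
        by (simp add: emeasure_density)
      then show ?thesis by (simp add: mass_def measure_def)
    qed
    have "frac_avg m \<alpha> f Q = 0" if "Q \<in> cubes" for Q
    proof -
      have "(\<Prod>i = 1..m. mass (f i) Q) = 0" using i(1) mass0[OF that] by (intro prod_zero) auto
      then show ?thesis by (simp add: frac_avg_def)
    qed
    then have "frac_maximal m \<alpha> f x = 0" for x
      using frac_maximal_le[OF m, of f x \<alpha> 0] fi by simp
    then show ?thesis using q_pos by (simp add: Lp_norm_def epowr_def)
  next
    case False
    then have Npos: "0 < N i" if "i \<in> {1..m}" for i
      using r0[of i] that by (auto simp: N_def)
    define g where "g i x = inverse (N i) * f i x" for i x
    have gm: "g i \<in> borel_measurable lebesgue" if "i \<in> {1..m}" for i
      using fm[OF that] unfolding g_def[abs_def] by simp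
    have gnorm: "(\<integral>\<^sup>+x. ennreal (\<bar>g i x\<bar> powr P i) * ennreal (w i x) \<partial>lebesgue) = 1" if i: "i \<in> {1..m}" for i
    proof -
      note [measurable] = fm[OF i] w_measurable[OF i]
      have rpos: "0 < r i" using False i r0[of i] by (auto simp: less_le)
      have "inverse (N i) powr P i = inverse (r i)"
        using rpos Ppos[OF i] by (simp add: N_def powr_powr inverse_powr)
      then have "ennreal (\<bar>g i x\<bar> powr P i) = ennreal (inverse (r i)) * ennreal (\<bar>f i x\<bar> powr P i)" for x
        using Npos[OF i] rpos by (simp add: g_def abs_mult powr_mult ennreal_mult)
      then have "(\<integral>\<^sup>+x. ennreal (\<bar>g i x\<bar> powr P i) * ennreal (w i x) \<partial>lebesgue)
          = ennreal (inverse (r i)) * ennreal (r i)"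
        using r[OF i] by (simp add: mult.assoc nn_integral_cmult)
      also have "\<dots> = 1" using rpos by (simp flip: ennreal_mult)
      finally show ?thesis .
    qed
    have gi: "cube_integrable (g i)" if "i \<in> {1..m}" for i
      using gm[OF that] gnorm[OF that] by (intro Lp_cube_integrable[OF that]) (simp add: Lp_space_def)
    have avg: "frac_avg m \<alpha> f Q = (\<Prod>i = 1..m. N i) * frac_avg m \<alpha> g Q" if "Q \<in> cubes" for Q
    proof -
      have "mass (f i) Q = N i * mass (g i) Q" if i: "i \<in> {1..m}" for i
        using mass_scale[OF gm[OF i] cubes_sets[OF \<open>Q \<in> cubes\<close>], of "N i"] Npos[OF i]
        by (simp add: g_def mult.assoc[symmetric])
      then show ?thesis by (simp add: frac_avg_def prod.distrib)
    qed
    have N0: "0 \<le> (\<Prod>i = 1..m. N i)" by (auto simp: N_def intro!: prod_nonneg)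
    have Mle: "frac_maximal m \<alpha> f x \<le> ennreal (\<Prod>i = 1..m. N i) * frac_maximal m \<alpha> g x" for x
    proof (rule frac_maximal_le[OF m])
      show "cube_integrable (f i)" if "i \<in> {1..m}" for i using fi[OF that] .
      fix Q :: "(real ^ 'n) set" assume Q: "Q \<in> cubes" "x \<in> Q"
      have "ennreal (frac_avg m \<alpha> g Q) \<le> frac_maximal m \<alpha> g x"
        using frac_maximal_ge[OF m _ Q, of g] gi by simp
      then show "ennreal (frac_avg m \<alpha> f Q) \<le> ennreal (\<Prod>i = 1..m. N i) * frac_maximal m \<alpha> g x"
        unfolding avg[OF Q(1)] using N0 by (simp add: ennreal_mult mult_left_mono)
    qed
    have gM [measurable]: "frac_maximal m \<alpha> g \<in> borel_measurable lebesgue"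
      using borel_measurable_frac_maximal[OF m, of g] gi by simp
    let ?N = "\<Prod>i = 1..m. N i"
    let ?D = "maximal_factor CARD('n) m \<alpha> p q P"
    have "(\<integral>\<^sup>+x. frac_maximal m \<alpha> f x epowr q * ennreal (v x) \<partial>lebesgue)
        \<le> (\<integral>\<^sup>+x. ennreal (?N powr q) * (frac_maximal m \<alpha> g x epowr q * ennreal (v x)) \<partial>lebesgue)"
    proof (rule nn_integral_mono)
      fix x
      have "frac_maximal m \<alpha> f x epowr q \<le> ennreal (?N powr q) * frac_maximal m \<alpha> g x epowr q"
        using epowr_mono[OF Mle, of q x] q_pos N0 by (simp add: epowr_mult)
      then show "frac_maximal m \<alpha> f x epowr q * ennreal (v x)
          \<le> ennreal (?N powr q) * (frac_maximal m \<alpha> g x epowr q * ennreal (v x))"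
        unfolding mult.assoc[symmetric] by (intro mult_right_mono) auto
    qed
    also have "\<dots> = ennreal (?N powr q) * (\<integral>\<^sup>+x. frac_maximal m \<alpha> g x epowr q * ennreal (v x) \<partial>lebesgue)"
      by (simp add: nn_integral_cmult)
    also have "\<dots> \<le> ennreal (?N powr q) * ennreal (?D * K powr q)"
      using normalized_estimate[of g] gi gnorm by (intro mult_left_mono) auto
    also have "\<dots> = ennreal (?N powr q * (?D * K powr q))"
      using maximal_factor_nonneg by (simp add: ennreal_mult)
    finally have "Lp_norm q v (frac_maximal m \<alpha> f) \<le> ennreal (?N powr q * (?D * K powr q)) epowr (1 / q)"
      unfolding Lp_norm_def using q_pos by (intro epowr_mono) auto
    also have "\<dots> = ennreal ((?N powr q * (?D * K powr q)) powr (1 / q))"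
      using maximal_factor_nonneg by simp
    also have "(?N powr q * (?D * K powr q)) powr (1 / q) = (?D powr (1 / q) * K) * ?N"
      using maximal_factor_nonneg N0 K_nonneg q_pos by (simp add: powr_mult powr_powr)
    also have "ennreal \<dots> = ennreal (?D powr (1 / q) * K) * ennreal ?N"
      using N0 K_nonneg by (intro ennreal_mult) auto
    finally show ?thesis by (simp only: prodN)
  qed
qed

end

section \<open>A constant uniform in the weights\<close>

theorem proposition1p3:
  fixes m :: nat and \<alpha> p q :: real and P :: "nat \<Rightarrow> real"
  assumes "m \<ge> 1"
    and "\<forall>i\<in>{1..m}. 1 < P i"
    and "0 \<le> \<alpha>" and "\<alpha> < real m * real CARD('n)"
    and "1 / p = (\<Sum>i = 1..m. 1 / P i)"
    and "p \<le> q"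
  shows "\<exists>C > 0. \<forall>(w :: nat \<Rightarrow> real ^ 'n::finite \<Rightarrow> real) v.
           (\<forall>i\<in>{1..m}. weight (w i)) \<and> weight v \<and>
           (\<forall>i\<in>{1..m}. weight (dual_weight P w i)) \<and>
           sawyer_const m \<alpha> p P q w v < \<infinity> \<longrightarrow>
             mult_bounded m P w q v (frac_maximal m \<alpha>) \<and>
             mult_op_norm m P w q v (frac_maximal m \<alpha>)
               \<le> ennreal C * sawyer_const m \<alpha> p P q w v"
proof -
  \<comment> \<open>Fixed before the weights are introduced; adding 1 makes it strictly
    positive.\<close>
  define C where "C = maximal_factor CARD('n) m \<alpha> p q P powr (1 / q) + 1"
  have "0 < C" by (simp add: C_def add_nonneg_pos)
  moreover have "mult_bounded m P w q v (frac_maximal m \<alpha>) \<and>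
      mult_op_norm m P w q v (frac_maximal m \<alpha>) \<le> ennreal C * sawyer_const m \<alpha> p P q w v"
    if *: "(\<forall>i\<in>{1..m}. weight (w i)) \<and> weight v \<and> (\<forall>i\<in>{1..m}. weight (dual_weight P w i)) \<and>
      sawyer_const m \<alpha> p P q w v < \<infinity>" for w :: "nat \<Rightarrow> real ^ 'n \<Rightarrow> real" and v
  proof -
    interpret sawyer_testing m \<alpha> p q P w v
      using assms * by unfold_locales auto
    have K: "sawyer_const m \<alpha> p P q w v = ennreal K" using testing by (simp add: K_def)
    have bound: "Lp_norm q v (frac_maximal m \<alpha> f)
        \<le> ennreal C * sawyer_const m \<alpha> p P q w v * (\<Prod>i = 1..m. Lp_norm (P i) (w i) (\<lambda>x. ennreal \<bar>f i x\<bar>))"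
      if f: "\<forall>i\<in>{1..m}. f i \<in> Lp_space (P i) (w i)" for f
    proof -
      have "Lp_norm q v (frac_maximal m \<alpha> f)
          \<le> ennreal (maximal_factor CARD('n) m \<alpha> p q P powr (1 / q) * K)
            * (\<Prod>i = 1..m. Lp_norm (P i) (w i) (\<lambda>x. ennreal \<bar>f i x\<bar>))"
        using f by (intro maximal_estimate) auto
      also have "ennreal (maximal_factor CARD('n) m \<alpha> p q P powr (1 / q) * K) \<le> ennreal C * ennreal K"
        using K_nonneg \<open>0 < C\<close>
        by (subst ennreal_mult[symmetric]) (auto simp: C_def intro!: ennreal_leI mult_right_mono)
      finally show ?thesis by (simp add: K mult_right_mono)
    qed
    have "frac_maximal m \<alpha> f \<in> borel_measurable lebesgue" if "\<forall>i\<in>{1..m}. f i \<in> Lp_space (P i) (w i)" for f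
      using borel_measurable_frac_maximal[OF m, of f] Lp_cube_integrable that by auto
    moreover have "ennreal C * sawyer_const m \<alpha> p P q w v < \<infinity>"
      by (simp add: K ennreal_mult_less_top)
    \<comment> \<open>The same finite constant witnesses boundedness and belongs to the set whose
      infimum is the operator norm.\<close>
    ultimately show ?thesis
      using bound unfolding mult_bounded_def mult_op_norm_def
      by (intro conjI exI[of _ "ennreal C * sawyer_const m \<alpha> p P q w v"] Inf_lower) auto
  qed
  ultimately show ?thesis by auto
qed

end
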